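(* Let $q\ge 1$ be an integer and let $K$ belong to $L^2(\Omega_{2q}^2)$. If $K=J*J$ for some $J$ in $\mathcal{B}^2(\Omega_{2q}^2)$, then $$\sum_{m,n=0}^{\infty}h_{m,n}^{q-2}\,|\langle K,Z_{m,n}\rangle_2|<\infty \quad\text{in the case } q\geq 2,$$ and $$\sum_{m=-\infty}^{\infty}|\langle K, Z_m \rangle_2|<\infty \quad\text{in the case } q=1.$$
   Context: $\Omega_{2q}$ is the unit sphere of $\mathbb{C}^q$, $\sigma_q$ its (rotation invariant) surface measure, and $\omega_q=2\pi^q/(q-1)!$ its total measure (so for $q=1$ it is the unit circle with arc length measure of total mass $2\pi$). A kernel on $\Omega_{2q}$ is a complex function on $\Omega_{2q}^2:=\Omega_{2q}\times\Omega_{2q}$; $L^2(\Omega_{2q}^2)=L^2(\Omega_{2q}^2,\sigma_q\times\sigma_q)$, with elements treated as functions and equality understood almost everywhere. The inner product is $\langle K_1,K_2\rangle_2=\frac{1}{\omega_q^2}\int_{\Omega_{2q}^2}K_1(x,y)\overline{K_2(x,y)}\,d(\sigma_q\times\sigma_q)(x,y)$. A kernel $K$ is zonal if $K(\rho(x),\rho(y))=K(x,y)$ for all $x,y\in\Omega_{2q}$ and all unitary linear operators $\rho$ on $\mathbb{C}^q$. $\mathcal{B}^2(\Omega_{2q}^2)$ is the space of all zonal kernels in $L^2(\Omega_{2q}^2)$. The generalized convolution is $(K_1*K_2)(x,y)=\frac{1}{\omega_q}\int_{\Omega_{2q}}K_1(x,\xi)K_2(\xi,y)\,d\sigma_q(\xi)$.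 Write $x\cdot y$ for the usual inner product of $\mathbb{C}^q$ (linear in $x$, conjugate-linear in $y$) and $B[0,1]=\{z\in\mathbb{C}:|z|\le 1\}$. For $q\ge 2$ and $m,n\in\mathbb{Z}_+=\{0,1,2,\dots\}$, the disk polynomial is $R_{m,n}^{q-2}(z)=r^{|m-n|}e^{i(m-n)\theta}\,P_{k}^{(q-2,|m-n|)}(2r^2-1)/P_{k}^{(q-2,|m-n|)}(1)$, $z=re^{i\theta}\in B[0,1]$, $k=\min\{m,n\}$, where $P_k^{(\alpha,\beta)}$ is the classical Jacobi polynomial; $h_{m,n}^{q-2}=\frac{m+n+q-1}{q-1}\binom{m+q-2}{q-2}\binom{n+q-2}{q-2}$; and $Z_{m,n}(x,y)=R_{m,n}^{q-2}(x\cdot y)$ for $x,y\in\Omega_{2q}$. For $q=1$ and $m\in\mathbb{Z}$, $Z_m(x,y)=(x\cdot y)^m=x^my^{-m}$ for $x,y\in\Omega_2$. *)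

theory Defs
  imports "HOL-Analysis.Analysis"
begin

text \<open>
  The space \<open>\<complex>\<^sup>q\<close> is \<open>complex ^ 'q\<close> with \<open>q = CARD('q)\<close>, and \<open>\<Omega>\<^bsub>2q\<^esub>\<close> is \<^term>\<open>sphere 0 1\<close> in it.
\<close>

subsection \<open>Surface measure of the unit sphere\<close>

text \<open>
  Surface measure by polar coordinates: the measure of a Borel set \<open>A\<close> of unit vectors is
  \<open>d\<close> times the Lebesgue measure of the cone \<open>{t x | x \<in> A, 0 < t < 1}\<close>, with \<open>d\<close> the real
  dimension of the ambient space. For \<open>d = 2\<close> this is arc length.
\<close>

definition surface_measure :: "'a::euclidean_space measure" where
  "surface_measure =
     scale_measure (ennreal (real DIM('a)))
       (distr (restrict_space lborel (ball 0 1 - {0})) (restrict_space borel (sphere 0 1))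
          (\<lambda>x. x /\<^sub>R norm x))"

lemma space_surface_measure [simp]: "space surface_measure = sphere 0 1"
  by (simp add: surface_measure_def space_scale_measure space_restrict_space)

lemma sets_surface_measure [simp, measurable_cong]:
  "sets surface_measure = sets (restrict_space borel (sphere 0 1))"
  by (simp add: surface_measure_def)

definition sphere_area :: "nat \<Rightarrow> real" where
  "sphere_area q = 2 * pi ^ q / fact (q - 1)"

lemma normalize_measurable:
  "(\<lambda>x::'a::euclidean_space. x /\<^sub>R norm x) \<in>
     measurable (restrict_space lborel (ball 0 1 - {0})) (restrict_space borel (sphere 0 1))"
  by (intro measurable_restrict_space3) (auto simp: Pi_iff)

lemma emeasure_surface_measure:
  assumes "A \<in> sets borel" and "A \<subseteq> sphere 0 1"
  shows "emeasure surface_measure (A :: 'a::euclidean_space set) =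
    ennreal (real DIM('a)) * emeasure lborel {x \<in> ball 0 1 - {0}. x /\<^sub>R norm x \<in> A}"
proof -
  have A: "A \<in> sets (restrict_space borel (sphere 0 1))"
    using assms by (auto simp: sets_restrict_space)
  have "(\<lambda>x. x /\<^sub>R norm x) -` A \<inter> space (restrict_space lborel (ball (0::'a) 1 - {0})) =
    {x \<in> ball 0 1 - {0}. x /\<^sub>R norm x \<in> A}"
    by (auto simp: space_restrict_space)
  then show ?thesis
    using normalize_measurable[where 'a='a] A
    by (simp add: surface_measure_def emeasure_scale_measure emeasure_distr)
       (subst emeasure_restrict_space; auto)
qed

lemma emeasure_surface_measure_sphere:
  "emeasure surface_measure (sphere (0 :: complex ^ 'q) 1) = ennreal (sphere_area CARD('q))"
proof -
  have "emeasure lborel (ball (0 :: complex ^ 'q) 1 - {0}) = emeasure lborel (ball (0 :: complex ^ 'q) 1)"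
    by (subst emeasure_Diff) auto
  moreover have "{x \<in> ball (0 :: complex ^ 'q) 1 - {0}. x /\<^sub>R norm x \<in> sphere 0 1} = ball 0 1 - {0}"
    by auto
  ultimately have "emeasure surface_measure (sphere (0 :: complex ^ 'q) 1) =
      ennreal (real (2 * CARD('q))) * ennreal (pi ^ CARD('q) / fact CARD('q))"
    using unit_ball_vol_even[of "CARD('q)"]
    by (subst emeasure_surface_measure) (auto simp: emeasure_ball mult.commute)
  also have "\<dots> = ennreal (real (2 * CARD('q)) * (pi ^ CARD('q) / fact CARD('q)))"
    by (subst ennreal_mult) auto
  also have "real (2 * CARD('q)) * (pi ^ CARD('q) / fact CARD('q)) = sphere_area CARD('q)"
    by (simp add: sphere_area_def fact_reduce[of "CARD('q)"] field_simps)
  finally show ?thesis .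
qed

subsection \<open>Kernels\<close>

definition cinner :: "complex ^ 'q \<Rightarrow> complex ^ 'q \<Rightarrow> complex" where
  "cinner x y = (\<Sum>i\<in>UNIV. x $ i * cnj (y $ i))"

definition unitary_operator :: "(complex ^ 'q \<Rightarrow> complex ^ 'q) \<Rightarrow> bool" where
  "unitary_operator \<rho> \<longleftrightarrow>
     Vector_Spaces.linear (*s) (*s) \<rho> \<and> bij \<rho> \<and> (\<forall>x y. cinner (\<rho> x) (\<rho> y) = cinner x y)"

text \<open>
  Kernels are total functions; every notion below only looks at their values on the sphere.
\<close>

type_synonym 'q kernel = "complex ^ 'q \<Rightarrow> complex ^ 'q \<Rightarrow> complex"

definition L2_kernel :: "'q::finite kernel \<Rightarrow> bool" where
  "L2_kernel K \<longleftrightarrow>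
     (\<lambda>(x, y). K x y) \<in> borel_measurable (surface_measure \<Otimes>\<^sub>M surface_measure) \<and>
     integrable (surface_measure \<Otimes>\<^sub>M surface_measure) (\<lambda>(x, y). (cmod (K x y))\<^sup>2)"

definition kernel_eq :: "'q::finite kernel \<Rightarrow> 'q kernel \<Rightarrow> bool" where
  "kernel_eq K L \<longleftrightarrow>
     (AE p in surface_measure \<Otimes>\<^sub>M surface_measure. K (fst p) (snd p) = L (fst p) (snd p))"

definition zonal :: "'q::finite kernel \<Rightarrow> bool" where
  "zonal K \<longleftrightarrow>
     (\<forall>\<rho>. unitary_operator \<rho> \<longrightarrow>
       (\<forall>x\<in>sphere 0 1. \<forall>y\<in>sphere 0 1. K (\<rho> x) (\<rho> y) = K x y))"

text \<open>
  Elements of \<open>L\<^sup>2\<close> are identified when equal almost everywhere, so membership in the space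
  of zonal kernels means having a zonal representative.
\<close>

definition zonal_L2_kernel :: "'q::finite kernel \<Rightarrow> bool" where
  "zonal_L2_kernel K \<longleftrightarrow> L2_kernel K \<and> (\<exists>L. L2_kernel L \<and> zonal L \<and> kernel_eq K L)"

definition kernel_inner :: "'q::finite kernel \<Rightarrow> 'q kernel \<Rightarrow> complex" where
  "kernel_inner K L =
     (1 / of_real ((sphere_area CARD('q))\<^sup>2)) *
     (\<integral>(x, y). K x y * cnj (L x y) \<partial>(surface_measure \<Otimes>\<^sub>M surface_measure))"

definition kernel_conv :: "'q::finite kernel \<Rightarrow> 'q kernel \<Rightarrow> 'q kernel" where
  "kernel_conv K L x y =
     (1 / of_real (sphere_area CARD('q))) * (\<integral>\<xi>. K x \<xi> * L \<xi> y \<partial>surface_measure)"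

subsection \<open>Disk polynomials\<close>

text \<open>The Jacobi polynomial \<open>P\<^sub>k\<close> with parameters \<open>\<alpha>, \<beta>\<close>, in the classical normalization
  (value \<open>(k + \<alpha>) gchoose k\<close> at \<open>1\<close>).\<close>

definition jacobi_P :: "nat \<Rightarrow> real \<Rightarrow> real \<Rightarrow> real \<Rightarrow> real" where
  "jacobi_P k \<alpha> \<beta> x =
     (\<Sum>s\<le>k. ((real k + \<alpha>) gchoose (k - s)) * ((real k + \<beta>) gchoose s) *
        ((x - 1) / 2) ^ s * ((x + 1) / 2) ^ (k - s))"

text \<open>Below, \<open>\<alpha>\<close> plays the role of \<open>q - 2\<close>.\<close>

definition disk_poly :: "nat \<Rightarrow> nat \<Rightarrow> nat \<Rightarrow> complex \<Rightarrow> complex" where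
  "disk_poly \<alpha> m n z =
     (let d = nat \<bar>int m - int n\<bar>; k = min m n; r = cmod z; \<theta> = Arg z in
       of_real (r ^ d) * exp (\<i> * of_int (int m - int n) * of_real \<theta>) *
       of_real (jacobi_P k (real \<alpha>) (real d) (2 * r\<^sup>2 - 1) / jacobi_P k (real \<alpha>) (real d) 1))"

definition disk_weight :: "nat \<Rightarrow> nat \<Rightarrow> nat \<Rightarrow> real" where
  "disk_weight \<alpha> m n =
     (real m + real n + real \<alpha> + 1) / (real \<alpha> + 1) *
     real ((m + \<alpha>) choose \<alpha>) * real ((n + \<alpha>) choose \<alpha>)"

definition Z_kernel :: "nat \<Rightarrow> nat \<Rightarrow> 'q::finite kernel" where
  "Z_kernel m n x y = disk_poly (CARD('q) - 2) m n (cinner x y)"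

definition Z_circle_kernel :: "int \<Rightarrow> 'q::finite kernel" where
  "Z_circle_kernel m x y = cinner x y powi m"

end

theory Submission
  imports Defs "HOL-Computational_Algebra.Polynomial"
begin

text \<open>
  Let \<open>P\<^sub>i\<close> run through the kernels \<open>h Z / \<omega>\<close>, where \<open>Z\<close> is one of the kernels of the theorem,
  \<open>h\<close> its weight (\<open>1\<close> on the circle) and \<open>\<omega>\<close> the area of the sphere. Everything rests on one fact:
  the \<open>P\<^sub>i\<close> are the integral kernels of mutually orthogonal projections of \<open>L\<^sup>2\<close> of the sphere. For then,
  up to a factor that does not depend on \<open>i\<close>, the term \<open>h \<langle>K, Z\<rangle>\<close> is the trace of \<open>P\<^sub>i J J P\<^sub>i\<close>. Its
  modulus is at most the product of the Hilbert-Schmidt norms of \<open>P\<^sub>i J\<close> and \<open>J P\<^sub>i\<close>, hence at most half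
  the sum of their squares, and by Bessel's inequality these squares sum over \<open>i\<close> to at most
  \<open>2 \<parallel>J\<parallel>\<^sup>2\<close>. This half of the argument holds for any finite measure and is
  \<open>sum_kernel_square_pairing_le\<close>; it avoids operators and traces by fixing the middle variable \<open>s\<close> of
  \<open>\<integral> J x s * J s y\<close>, which leaves an inequality about the two functions \<open>J (_, s)\<close> and \<open>J (s, _)\<close>.

  It remains to see that \<open>Z\<^sub>m\<^sub>,\<^sub>n * Z\<^sub>m\<^sub>'\<^sub>,\<^sub>n\<^sub>'\<close> vanishes when the indices differ and is \<open>Z\<^sub>m\<^sub>,\<^sub>n / h\<close> otherwise
  (\<open>full_disk_kernel_conv\<close>). If \<open>m - n\<close> and \<open>m' - n'\<close> differ, multiplying the integration variable by
  a unit scalar shows that the integral is \<open>0\<close>. If both are \<open>d \<ge> 0\<close>, expand the second kernel into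
  the products \<open>(\<xi> \<cdot> y)\<^bsup>b + d\<^esup> (y \<cdot> \<xi>)\<^bsup>b\<^esup>\<close> and write \<open>y = a x + y'\<close> with \<open>y'\<close> orthogonal to \<open>x\<close>. Rotating the
  complement of \<open>x\<close> kills every term of the binomial expansion with unequal powers of \<open>\<xi> \<cdot> y'\<close> and
  \<open>y' \<cdot> \<xi>\<close>, and in the others \<open>\<bar>\<xi> \<cdot> y'\<bar>\<^bsup>2s\<^esup>\<close> may be replaced by a constant times \<open>(1 - t)\<^bsup>s\<^esup>\<close>, where
  \<open>t = \<bar>x \<cdot> \<xi>\<bar>\<^sup>2\<close>. What is left are averages of polynomials in \<open>t\<close>, that is, integrals against
  \<open>(1 - t)\<^bsup>q-2\<^esup> dt\<close> on \<open>[0,1]\<close>. The radial part of \<open>Z\<^sub>m\<^sub>,\<^sub>n\<close> is a Jacobi polynomial of degree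
  \<open>k = min m n\<close>, orthogonal to all polynomials of lower degree for the weight \<open>t\<^bsup>d\<^esup> (1 - t)\<^bsup>q-2\<^esup>\<close>. So the
  terms with \<open>b < k\<close> vanish, and for \<open>b = k\<close> the surviving sum is, coefficient by coefficient, again
  the explicit formula of that Jacobi polynomial (\<open>disk_kernel_conv_monomial\<close>).

  No integral over the sphere is ever computed in coordinates: invariance under unitary maps and
  \<open>\<bar>\<xi>\<bar> = 1\<close> determine all moments that occur (\<open>sphere_avg_moment\<close>).
\<close>

section \<open>Orthogonal invariance of surface measure\<close>

lemma borel_measurable_linear:
  fixes f :: "'a::euclidean_space \<Rightarrow> 'b::euclidean_space"
  assumes "linear f"
  shows "f \<in> borel_measurable borel"
  by (intro borel_measurable_continuous_onI linear_continuous_on linear_conv_bounded_linear[THEN iffD1] assms)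

text \<open>
  Boxes determine Lebesgue measure, and the preimage of a box under \<open>f\<close> is its image under the
  orthogonal map \<open>inv f\<close>, which preserves volume.
\<close>

lemma lborel_distr_orthogonal_vec:
  fixes f :: "real ^ 'n::{finite,wellorder} \<Rightarrow> real ^ 'n::_"
  assumes f: "orthogonal_transformation f"
  shows "distr lborel borel f = lborel"
proof (rule lborel_eqI [symmetric])
  fix l u :: "real ^ 'n::_"
  assume lu: "\<And>b. b \<in> Basis \<Longrightarrow> l \<bullet> b \<le> u \<bullet> b"
  have g: "orthogonal_transformation (inv f)"
    by (rule orthogonal_transformation_inv [OF f])
  have vi: "f -` box l u = inv f ` box l u"
    by (rule bij_vimage_eq_inv_image [OF orthogonal_transformation_bij [OF f]])
  have m: "f \<in> borel_measurable borel"
    using f by (simp add: borel_measurable_linear orthogonal_transformation_linear)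
  have S: "inv f ` box l u \<in> lmeasurable" "measure lebesgue (inv f ` box l u) = measure lebesgue (box l u)"
    using measurable_orthogonal_image[OF g, of "box l u"] measure_orthogonal_image[OF g, of "box l u"]
    by (auto simp: lmeasurable_box)
  have "emeasure (distr lborel borel f) (box l u) = emeasure lborel (f -` box l u)"
    using m by (simp add: emeasure_distr)
  also have "\<dots> = emeasure lebesgue (f -` box l u)"
    using measurable_sets[OF m, of "box l u"] by simp
  also have "\<dots> = emeasure lebesgue (box l u)"
    unfolding vi using S by (simp add: emeasure_eq_measure2)
  also have "\<dots> = (\<Prod>b\<in>Basis. (u - l) \<bullet> b)"
    using lu by simp
  finally show "emeasure (distr lborel borel f) (box l u) = (\<Prod>b\<in>Basis. (u - l) \<bullet> b)" .
qed simp

text \<open>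
  Coordinates with respect to an enumeration of the standard basis turn boxes into boxes with
  the same side lengths.
\<close>

lemma lborel_distr_coordinates:
  fixes e :: "'n::finite \<Rightarrow> 'a::euclidean_space"
  assumes e: "bij_betw e UNIV Basis"
  shows "distr lborel borel (\<lambda>x. \<chi> i. x \<bullet> e i) = lborel"
    and "distr lborel borel (\<lambda>y. \<Sum>i\<in>UNIV. y $ i *\<^sub>R e i) = lborel"
proof -
  let ?S = "\<lambda>x. \<chi> i. x \<bullet> e i" and ?T = "\<lambda>y. \<Sum>i\<in>UNIV. y $ i *\<^sub>R e i"
  have linS: "linear ?S"
    by (rule linearI) (auto simp: vec_eq_iff inner_add_left)
  have linT: "linear ?T"
    by (rule linearI) (auto simp: scaleR_left_distrib sum.distrib scaleR_sum_right)
  note meas = borel_measurable_linear[OF linS] borel_measurable_linear[OF linT]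
  have BE: "Basis = e ` UNIV" and inj: "inj e"
    using e by (auto simp: bij_betw_def)
  have ee: "e i \<bullet> e j = (if i = j then 1 else 0)" for i j
    using inj by (auto simp: BE inner_Basis inj_eq)
  have TS: "?T (?S x) = x" for x
  proof -
    have "?T (?S x) = (\<Sum>b\<in>Basis. (x \<bullet> b) *\<^sub>R b)"
      unfolding BE by (subst sum.reindex[OF inj]) simp
    then show ?thesis
      by (simp add: euclidean_representation)
  qed
  have Te: "?T y \<bullet> e i = y $ i" for y i
    by (simp add: inner_sum_left ee if_distrib [where f = "\<lambda>c. _ * c"] cong: if_cong)
  have B: "(\<Prod>b\<in>Basis. f b) = (\<Prod>i\<in>UNIV. f (e i))" for f :: "'a \<Rightarrow> real"
    unfolding BE by (subst prod.reindex[OF inj]) simp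
  have BV: "Basis = range (\<lambda>i::'n. axis i (1::real))"
    by (auto simp: Basis_vec_def)
  have "inj (\<lambda>i::'n. axis i (1::real))"
    by (auto simp: inj_on_def axis_eq_axis)
  then have C: "(\<Prod>b\<in>Basis. f b) = (\<Prod>i\<in>UNIV. f (axis i 1))" for f :: "real ^ 'n \<Rightarrow> real"
    unfolding BV by (subst prod.reindex) auto
  show 1: "distr lborel borel ?S = lborel"
  proof (rule lborel_eqI [symmetric])
    fix l u :: "real ^ 'n::_"
    assume lu: "\<And>b. b \<in> Basis \<Longrightarrow> l \<bullet> b \<le> u \<bullet> b"
    have lu': "l $ i \<le> u $ i" for i
      using lu[of "axis i 1"] by (simp add: BV inner_axis)
    have "?S -` box l u = box (?T l) (?T u)"
      by (auto simp: box_def BE BV inner_axis Te)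
    then have "emeasure (distr lborel borel ?S) (box l u) = emeasure lborel (box (?T l) (?T u))"
      using meas by (subst emeasure_distr) auto
    also have "\<dots> = (\<Prod>b\<in>Basis. (?T u - ?T l) \<bullet> b)"
      using lu' by (subst emeasure_lborel_box) (auto simp: BE Te)
    also have "(\<Prod>b\<in>Basis. (?T u - ?T l) \<bullet> b) = (\<Prod>b\<in>Basis. (u - l) \<bullet> b)"
      by (simp add: B C inner_diff_left Te inner_axis)
    finally show "emeasure (distr lborel borel ?S) (box l u) = (\<Prod>b\<in>Basis. (u - l) \<bullet> b)" .
  qed simp
  have "distr lborel borel ?T = distr (distr lborel borel ?S) borel ?T"
    by (simp add: 1)
  also have "\<dots> = distr lborel borel (?T \<circ> ?S)"
    using meas by (intro distr_distr) auto
  also have "\<dots> = distr lborel lborel (\<lambda>x. x)"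
    by (intro distr_cong) (auto simp only: o_def TS sets_lborel)
  finally show "distr lborel borel ?T = lborel"
    by (simp add: distr_id)
qed

text \<open>
  Transports the invariance of Lebesgue measure on coordinate vectors to an abstract Euclidean
  space, by conjugating \<open>f\<close> with the coordinate map.
\<close>

lemma lborel_distr_orthogonal:
  fixes f :: "'a::euclidean_space \<Rightarrow> 'a" and e :: "'n::{finite,wellorder} \<Rightarrow> 'a"
  assumes e: "bij_betw e UNIV Basis" and f: "orthogonal_transformation f"
  shows "distr lborel borel f = lborel"
proof -
  let ?S = "\<lambda>x. \<chi> i. x \<bullet> e i" and ?T = "\<lambda>y. \<Sum>i\<in>UNIV. y $ i *\<^sub>R e i"
  have linS: "linear ?S"
    by (rule linearI) (auto simp: vec_eq_iff inner_add_left)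
  have linT: "linear ?T"
    by (rule linearI) (auto simp: scaleR_left_distrib sum.distrib scaleR_sum_right)
  note linf = orthogonal_transformation_linear[OF f]
  note meas = borel_measurable_linear[OF linS] borel_measurable_linear[OF linT] borel_measurable_linear[OF linf]
  have BE: "Basis = e ` UNIV" and inj: "inj e"
    using e by (auto simp: bij_betw_def)
  have ee: "e i \<bullet> e j = (if i = j then 1 else 0)" for i j
    using inj by (auto simp: BE inner_Basis inj_eq)
  have TS: "?T (?S x) = x" for x
  proof -
    have "?T (?S x) = (\<Sum>b\<in>Basis. (x \<bullet> b) *\<^sub>R b)"
      unfolding BE by (subst sum.reindex[OF inj]) simp
    then show ?thesis
      by (simp add: euclidean_representation)
  qed
  have TT: "?T y \<bullet> ?T z = y \<bullet> z" for y z
    by (simp add: inner_sum_left inner_sum_right inner_vec_def ee mult.commute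
        if_distrib [where f = "\<lambda>c. _ * c"] cong: if_cong)
  have SS: "?S x \<bullet> ?S y = x \<bullet> y" for x y
    unfolding TT [symmetric] TS ..
  have "orthogonal_transformation (?S \<circ> f \<circ> ?T)"
    using f unfolding orthogonal_transformation_def
    by (intro conjI allI linear_compose linS linT) (auto simp only: o_def SS TT)
  then have 1: "distr lborel borel (?S \<circ> f \<circ> ?T) = lborel"
    by (rule lborel_distr_orthogonal_vec)
  have "distr lborel borel f = distr (distr lborel borel ?T) borel f"
    by (simp add: lborel_distr_coordinates[OF e])
  also have "\<dots> = distr lborel borel (f \<circ> ?T)"
    using meas by (intro distr_distr) auto
  also have "\<dots> = distr lborel borel (?T \<circ> (?S \<circ> f \<circ> ?T))"
    by (simp only: o_def TS)
  also have "\<dots> = distr (distr lborel borel (?S \<circ> f \<circ> ?T)) borel ?T"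
    using meas by (intro distr_distr[symmetric]) (auto intro!: measurable_comp simp del: o_apply)
  also have "\<dots> = lborel"
    unfolding 1 by (rule lborel_distr_coordinates[OF e])
  finally show ?thesis .
qed

lemma lborel_distr_orthogonal_complex:
  fixes f :: "complex ^ 'q::finite \<Rightarrow> complex ^ 'q"
  assumes f: "orthogonal_transformation f"
  shows "distr lborel borel f = lborel"
proof -
  \<comment> \<open>\<open>'q bit0\<close> is a well-ordered index type with \<open>2 q\<close> elements, the real dimension of the space.\<close>
  have "card (UNIV :: 'q bit0 set) = card (Basis :: (complex ^ 'q) set)"
    by simp
  then obtain e :: "'q bit0 \<Rightarrow> complex ^ 'q" where "bij_betw e UNIV Basis"
    using finite_same_card_bij[of "UNIV :: 'q bit0 set" "Basis :: (complex ^ 'q) set"] by auto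
  then show ?thesis
    by (rule lborel_distr_orthogonal) (rule f)
qed

lemma finite_measure_surface_measure: "finite_measure (surface_measure :: (complex ^ 'q::finite) measure)"
  by (rule finite_measureI) (simp add: emeasure_surface_measure_sphere)

text \<open>
  An orthogonal map commutes with \<open>x \<mapsto> x / \<bar>x\<bar>\<close>, so it maps the cone over a set of unit
  vectors to the cone over the image of this set; and it preserves the volume of cones.
\<close>

lemma surface_measure_distr_orthogonal:
  fixes f :: "complex ^ 'q::finite \<Rightarrow> complex ^ 'q"
  assumes f: "orthogonal_transformation f"
  shows "f \<in> surface_measure \<rightarrow>\<^sub>M surface_measure"
    and "distr surface_measure surface_measure f = surface_measure"
proof -
  have nf: "norm (f x) = norm x" for x
    using orthogonal_transformation_norm[OF f] .
  have lin: "linear f"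
    by (rule orthogonal_transformation_linear[OF f])
  have m: "f \<in> borel_measurable borel"
    by (rule borel_measurable_linear[OF lin])
  have "f \<in> restrict_space borel (sphere 0 1) \<rightarrow>\<^sub>M restrict_space borel (sphere 0 1)"
    using m by (intro measurable_restrict_space3) (auto simp: nf)
  then show ms: "f \<in> surface_measure \<rightarrow>\<^sub>M surface_measure"
    by (simp cong: measurable_cong_sets)
  show "distr surface_measure surface_measure f = surface_measure"
  proof (rule measure_eqI)
    fix A assume "A \<in> sets (distr surface_measure surface_measure f)"
    then have "A \<in> sets (restrict_space borel (sphere 0 1))"
      by simp
    then have A: "A \<in> sets borel" "A \<subseteq> sphere 0 1" "A \<in> sets surface_measure"
      by (auto simp: sets_restrict_space)
    define N where "N x = x /\<^sub>R norm x" for x :: "complex ^ 'q"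
    have Nf: "N (f x) = f (N x)" for x
      by (simp add: N_def nf linear_scale[OF lin])
    have Nm: "{x \<in> ball 0 1 - {0}. x /\<^sub>R norm x \<in> A} \<in> sets borel"
    proof -
      have "(\<lambda>x. x /\<^sub>R norm x) -` A \<inter> space (restrict_space lborel (ball 0 1 - {0}))
          \<in> sets (restrict_space lborel (ball 0 1 - {0}))"
        using normalize_measurable A(3) by (intro measurable_sets) auto
      then have "(\<lambda>x. x /\<^sub>R norm x) -` A \<inter> (ball 0 1 - {0}) \<in> sets borel"
        by (auto simp: space_restrict_space sets_restrict_space)
      moreover have "(\<lambda>x. x /\<^sub>R norm x) -` A \<inter> (ball 0 1 - {0}) = {x \<in> ball 0 1 - {0}. x /\<^sub>R norm x \<in> A}"
        by auto
      ultimately show ?thesis by simp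
    qed
    have pre: "f -` A \<inter> sphere 0 1 \<in> sets borel"
      using measurable_sets[OF m A(1)] by auto
    have f0: "f x = 0 \<longleftrightarrow> x = 0" for x
      by (metis nf norm_eq_zero)
    have N1: "norm (N x) = 1" if "x \<noteq> 0" for x
      using that by (simp add: N_def)
    have *: "f -` {x \<in> ball 0 1 - {0}. N x \<in> A} = {x \<in> ball 0 1 - {0}. N x \<in> f -` A \<inter> sphere 0 1}"
      by (rule set_eqI) (simp add: nf Nf f0 N1 cong: conj_cong)
    have "emeasure (distr surface_measure surface_measure f) A = emeasure surface_measure (f -` A \<inter> sphere 0 1)"
      using ms A by (subst emeasure_distr) auto
    also have "\<dots> = ennreal (real DIM(complex ^ 'q)) * emeasure lborel {x \<in> ball 0 1 - {0}. N x \<in> f -` A \<inter> sphere 0 1}"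
      unfolding N_def using pre by (rule emeasure_surface_measure) auto
    also have "emeasure lborel {x \<in> ball 0 1 - {0}. N x \<in> f -` A \<inter> sphere 0 1}
        = emeasure (distr lborel borel f) {x \<in> ball 0 1 - {0}. N x \<in> A}"
      unfolding *[symmetric] using m Nm by (subst emeasure_distr) (auto simp: N_def)
    also have "\<dots> = emeasure lborel {x \<in> ball 0 1 - {0}. x /\<^sub>R norm x \<in> A}"
      by (simp add: lborel_distr_orthogonal_complex[OF f] N_def)
    also have "ennreal (real DIM(complex ^ 'q)) * \<dots> = emeasure surface_measure A"
      by (rule emeasure_surface_measure[symmetric]) (use A in auto)
    finally show "emeasure (distr surface_measure surface_measure f) A = emeasure surface_measure A" .
  qed simp
qed

section \<open>Kernels of orthogonal projections and a trace estimate\<close>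

definition integral_op :: "'a measure \<Rightarrow> ('a \<Rightarrow> 'a \<Rightarrow> complex) \<Rightarrow> ('a \<Rightarrow> complex) \<Rightarrow> 'a \<Rightarrow> complex" where
  "integral_op M P u x = (\<integral>y. P x y * u y \<partial>M)"

definition L2_function :: "'a measure \<Rightarrow> ('a \<Rightarrow> complex) \<Rightarrow> bool" where
  "L2_function M u \<longleftrightarrow> u \<in> borel_measurable M \<and> integrable M (\<lambda>x. (cmod (u x))\<^sup>2)"

text \<open>
  A bounded kernel that is Hermitian and idempotent under composition: the integral kernel of
  an orthogonal projection of \<open>L\<^sup>2\<close>. Boundedness supplies the dominating functions for Fubini.
\<close>

definition projection_kernel :: "'a measure \<Rightarrow> ('a \<Rightarrow> 'a \<Rightarrow> complex) \<Rightarrow> bool" where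
  "projection_kernel M P \<longleftrightarrow>
     (\<lambda>(x, y). P x y) \<in> borel_measurable (M \<Otimes>\<^sub>M M) \<and>
     (\<exists>C. \<forall>x\<in>space M. \<forall>y\<in>space M. cmod (P x y) \<le> C) \<and>
     (\<forall>x\<in>space M. \<forall>y\<in>space M. P y x = cnj (P x y)) \<and>
     (\<forall>x\<in>space M. \<forall>y\<in>space M. (\<integral>z. P x z * P z y \<partial>M) = P x y)"

lemma projection_kernelD:
  assumes "projection_kernel M P"
  shows "(\<lambda>(x, y). P x y) \<in> borel_measurable (M \<Otimes>\<^sub>M M)"
    and "\<exists>C. \<forall>x\<in>space M. \<forall>y\<in>space M. cmod (P x y) \<le> C"
    and "x \<in> space M \<Longrightarrow> y \<in> space M \<Longrightarrow> P y x = cnj (P x y)"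
    and "x \<in> space M \<Longrightarrow> y \<in> space M \<Longrightarrow> (\<integral>z. P x z * P z y \<partial>M) = P x y"
  using assms unfolding projection_kernel_def by blast+

context finite_measure
begin

lemma L2_function_integrable:
  assumes "L2_function M u"
  shows "integrable M u"
proof (rule Bochner_Integration.integrable_bound)
  show "integrable M (\<lambda>x. 1 + (cmod (u x))\<^sup>2)"
    using assms by (auto simp: L2_function_def)
  show "u \<in> borel_measurable M"
    using assms by (simp add: L2_function_def)
  \<comment> \<open>\<open>1 + a\<^sup>2 - a = (a - 1/2)\<^sup>2 + 3/4\<close>\<close>
  have "a \<le> 1 + a\<^sup>2" for a :: real
    using sum_power2_ge_zero[of "a - 1/2" 0] by (auto simp: power2_eq_square algebra_simps)
  then show "AE x in M. norm (u x) \<le> norm (1 + (cmod (u x))\<^sup>2)"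
    by simp
qed

lemma L2_function_cnj:
  assumes "L2_function M u"
  shows "L2_function M (\<lambda>x. cnj (u x))"
  using assms unfolding L2_function_def
  by (auto intro!: borel_measurable_continuous_on[OF continuous_on_cnj[OF continuous_on_id]])

lemma L2_function_mult_integrable:
  assumes "L2_function M u" "L2_function M v"
  shows "integrable M (\<lambda>x. u x * v x)"
proof (rule Bochner_Integration.integrable_bound)
  show "integrable M (\<lambda>x. (cmod (u x))\<^sup>2 + (cmod (v x))\<^sup>2)"
    using assms by (auto simp: L2_function_def)
  show "(\<lambda>x. u x * v x) \<in> borel_measurable M"
    using assms by (auto simp: L2_function_def)
  have "a * b \<le> a\<^sup>2 + b\<^sup>2" for a b :: real
  proof -
    have "2 * (a * b) \<le> a\<^sup>2 + b\<^sup>2"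
      using sum_squares_bound[of a b] by (simp add: mult.assoc)
    then show ?thesis
      using zero_le_power2[of a] zero_le_power2[of b] by linarith
  qed
  then show "AE x in M. norm (u x * v x) \<le> norm ((cmod (u x))\<^sup>2 + (cmod (v x))\<^sup>2)"
    by (auto simp: norm_mult)
qed

lemma L2_function_bounded:
  assumes "u \<in> borel_measurable M" "\<And>x. x \<in> space M \<Longrightarrow> cmod (u x) \<le> C"
  shows "L2_function M u"
  unfolding L2_function_def
  using assms by (auto intro!: integrable_const_bound[where B="C\<^sup>2"] power_mono AE_I2)

lemma integral_op_L2:
  assumes P: "projection_kernel M P" and u: "L2_function M u"
  shows "L2_function M (integral_op M P u)"
proof -
  obtain C where C: "\<And>x y. x \<in> space M \<Longrightarrow> y \<in> space M \<Longrightarrow> cmod (P x y) \<le> C"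
    using projection_kernelD(2)[OF P] by blast
  have [measurable]: "(\<lambda>(x, y). P x y) \<in> borel_measurable (M \<Otimes>\<^sub>M M)" "u \<in> borel_measurable M"
    using projection_kernelD(1)[OF P] u by (auto simp: L2_function_def)
  have "integral_op M P u \<in> borel_measurable M"
    unfolding integral_op_def by measurable
  moreover have "cmod (integral_op M P u x) \<le> (\<integral>y. C * cmod (u y) \<partial>M)" if x: "x \<in> space M" for x
  proof -
    have "cmod (integral_op M P u x) \<le> (\<integral>y. cmod (P x y * u y) \<partial>M)"
      unfolding integral_op_def by (rule integral_norm_bound)
    also have "\<dots> \<le> (\<integral>y. C * cmod (u y) \<partial>M)"
      using L2_function_integrable[OF u] C[OF x] order_trans[OF norm_ge_zero C[OF x x]]
      by (intro integral_mono_AE') (auto intro!: AE_I2 mult_right_mono simp: norm_mult intro: order_trans[OF norm_ge_zero])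
    finally show ?thesis .
  qed
  ultimately show ?thesis
    by (rule L2_function_bounded)
qed

lemma projection_kernel_slice:
  assumes P: "projection_kernel M P" and y: "y \<in> space M"
  shows "L2_function M (P y)" "L2_function M (\<lambda>x. P x y)"
proof -
  obtain C where C: "\<And>x y. x \<in> space M \<Longrightarrow> y \<in> space M \<Longrightarrow> cmod (P x y) \<le> C"
    using projection_kernelD(2)[OF P] by blast
  have [measurable]: "(\<lambda>(x, y). P x y) \<in> borel_measurable (M \<Otimes>\<^sub>M M)"
    using projection_kernelD(1)[OF P] .
  have [measurable]: "P y \<in> borel_measurable M" "(\<lambda>x. P x y) \<in> borel_measurable M"
    using measurable_Pair2[of "\<lambda>(x, y). P x y" M M borel y]
      measurable_Pair1[of "\<lambda>(x, y). P x y" M M borel y] y by auto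
  show "L2_function M (P y)" "L2_function M (\<lambda>x. P x y)"
    using y C by (auto intro!: L2_function_bounded)
qed

lemma integrable_weighted_kernel:
  assumes P: "projection_kernel M P" and u: "integrable M u" and w: "integrable M w"
  shows "integrable (M \<Otimes>\<^sub>M M) (\<lambda>(x, y). P x y * u y * w x)"
proof -
  interpret MM: pair_sigma_finite M M by standard
  obtain C where C: "\<And>x y. x \<in> space M \<Longrightarrow> y \<in> space M \<Longrightarrow> cmod (P x y) \<le> C"
    using projection_kernelD(2)[OF P] by blast
  have [measurable]: "(\<lambda>(x, y). P x y) \<in> borel_measurable (M \<Otimes>\<^sub>M M)"
    "u \<in> borel_measurable M" "w \<in> borel_measurable M"
    using projection_kernelD(1)[OF P] u w by auto
  have "integrable (M \<Otimes>\<^sub>M M) (\<lambda>p. C * (u (snd p) * w (fst p)))"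
    using u w by (intro integrable_mult_right MM.Fubini_integrable) (auto simp: norm_mult)
  then show ?thesis
  proof (rule Bochner_Integration.integrable_bound)
    show "AE p in M \<Otimes>\<^sub>M M. norm (case p of (x, y) \<Rightarrow> P x y * u y * w x) \<le> norm (C * (u (snd p) * w (fst p)))"
    proof (rule AE_I2)
      fix p assume "p \<in> space (M \<Otimes>\<^sub>M M)"
      then obtain x y where p: "p = (x, y)" "x \<in> space M" "y \<in> space M"
        by (auto simp: space_pair_measure)
      have "0 \<le> C"
        using C[OF p(2,3)] order_trans[OF norm_ge_zero] by blast
      then show "norm (case p of (x, y) \<Rightarrow> P x y * u y * w x) \<le> norm (C * (u (snd p) * w (fst p)))"
        using C[OF p(2,3)] by (simp add: p norm_mult mult.assoc mult_right_mono)
    qed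
  qed measurable
qed

lemma integral_op_transpose:
  assumes P: "projection_kernel M P" and u: "L2_function M u" and w: "L2_function M w"
  shows "(\<integral>x. integral_op M P u x * w x \<partial>M) = (\<integral>y. u y * (\<integral>x. P x y * w x \<partial>M) \<partial>M)"
proof -
  interpret MM: pair_sigma_finite M M by standard
  note int = integrable_weighted_kernel[OF P L2_function_integrable[OF u] L2_function_integrable[OF w]]
  have "(\<integral>x. integral_op M P u x * w x \<partial>M) = (\<integral>x. \<integral>y. P x y * u y * w x \<partial>M \<partial>M)"
    by (simp add: integral_op_def)
  also have "\<dots> = (\<integral>y. \<integral>x. P x y * u y * w x \<partial>M \<partial>M)"
    using MM.Fubini_integral[OF int] by simp
  also have "\<dots> = (\<integral>y. u y * (\<integral>x. P x y * w x \<partial>M) \<partial>M)"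
  proof (rule Bochner_Integration.integral_cong)
    fix y
    have "(\<lambda>x. P x y * u y * w x) = (\<lambda>x. u y * (P x y * w x))"
      by (simp add: mult_ac)
    then show "(\<integral>x. P x y * u y * w x \<partial>M) = u y * (\<integral>x. P x y * w x \<partial>M)"
      by simp
  qed simp
  finally show ?thesis .
qed

lemma integral_op_idem:
  assumes P: "projection_kernel M P" and u: "L2_function M u" and y: "y \<in> space M"
  shows "integral_op M P (integral_op M P u) y = integral_op M P u y"
proof -
  have "integral_op M P (integral_op M P u) y = (\<integral>x. integral_op M P u x * P y x \<partial>M)"
    unfolding integral_op_def[of M P "integral_op M P u"] by (simp add: mult.commute)
  also have "\<dots> = (\<integral>z. u z * (\<integral>x. P x z * P y x \<partial>M) \<partial>M)"
    by (rule integral_op_transpose[OF P u projection_kernel_slice(1)[OF P y]])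
  also have "\<dots> = (\<integral>z. P y z * u z \<partial>M)"
    using projection_kernelD(4)[OF P y]
    by (intro Bochner_Integration.integral_cong) (auto simp: mult.commute)
  finally show ?thesis
    by (simp add: integral_op_def)
qed

text \<open>
  \<open>\<langle>T u, T w\<rangle> = \<langle>T u, w\<rangle>\<close>, because the operator \<open>T\<close> is idempotent and self-adjoint.
\<close>

lemma integral_op_inner:
  assumes P: "projection_kernel M P" and u: "L2_function M u" and w: "L2_function M w"
  shows "(\<integral>x. integral_op M P u x * cnj (integral_op M P w x) \<partial>M) =
         (\<integral>x. integral_op M P u x * cnj (w x) \<partial>M)"
proof -
  have cw: "L2_function M (\<lambda>x. cnj (w x))"
    by (rule L2_function_cnj[OF w])
  have "(\<integral>x. integral_op M P u x * cnj (w x) \<partial>M) = (\<integral>x. integral_op M P (integral_op M P u) x * cnj (w x) \<partial>M)"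
    by (intro Bochner_Integration.integral_cong) (auto simp: integral_op_idem[OF P u])
  also have "\<dots> = (\<integral>y. integral_op M P u y * (\<integral>x. P x y * cnj (w x) \<partial>M) \<partial>M)"
    by (rule integral_op_transpose[OF P integral_op_L2[OF P u] cw])
  also have "\<dots> = (\<integral>x. integral_op M P u x * cnj (integral_op M P w x) \<partial>M)"
  proof (rule Bochner_Integration.integral_cong)
    fix y assume y: "y \<in> space M"
    have "(\<integral>x. P x y * cnj (w x) \<partial>M) = (\<integral>x. cnj (P y x * w x) \<partial>M)"
      using projection_kernelD(3)[OF P y] by (intro Bochner_Integration.integral_cong) auto
    then show "integral_op M P u y * (\<integral>x. P x y * cnj (w x) \<partial>M) =
        integral_op M P u y * cnj (integral_op M P w y)"
      unfolding integral_op_def by (simp only: Bochner_Integration.integral_cnj)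
  qed simp
  finally show ?thesis ..
qed

text \<open>
  Expand \<open>0 \<le> \<parallel>u - T u\<parallel>\<^sup>2\<close>; the mixed terms equal \<open>\<parallel>T u\<parallel>\<^sup>2\<close> by \<open>integral_op_inner\<close>.
\<close>

lemma integral_op_norm_le:
  assumes P: "projection_kernel M P" and u: "L2_function M u"
  shows "(\<integral>x. (cmod (integral_op M P u x))\<^sup>2 \<partial>M) \<le> (\<integral>x. (cmod (u x))\<^sup>2 \<partial>M)"
    (is "?T \<le> ?U")
proof -
  let ?t = "integral_op M P u"
  note t = integral_op_L2[OF P u]
  have cu: "L2_function M (\<lambda>x. cnj (u x))"
    by (rule L2_function_cnj[OF u])
  have i: "integrable M (\<lambda>x. Re (?t x * cnj (u x)))"
    by (rule integrable_Re[OF L2_function_mult_integrable[OF t cu]])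
  have iu: "integrable M (\<lambda>x. (cmod (u x))\<^sup>2)" and it: "integrable M (\<lambda>x. (cmod (?t x))\<^sup>2)"
    using u t by (auto simp: L2_function_def)
  have "complex_of_real ?T = (\<integral>x. ?t x * cnj (?t x) \<partial>M)"
    by (simp add: complex_norm_square[symmetric] flip: integral_complex_of_real)
  also have "\<dots> = (\<integral>x. ?t x * cnj (u x) \<partial>M)"
    by (rule integral_op_inner[OF P u u])
  finally have eq: "?T = (\<integral>x. Re (?t x * cnj (u x)) \<partial>M)"
    using integral_Re[OF L2_function_mult_integrable[OF t cu]] by (metis Re_complex_of_real)
  have "0 \<le> (\<integral>x. (cmod (u x - ?t x))\<^sup>2 \<partial>M)"
    by (rule Bochner_Integration.integral_nonneg) simp
  also have "\<dots> = (\<integral>x. (cmod (u x))\<^sup>2 + (cmod (?t x))\<^sup>2 - 2 * Re (?t x * cnj (u x)) \<partial>M)"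
    by (intro Bochner_Integration.integral_cong refl)
      (unfold cmod_power2, simp add: power2_eq_square algebra_simps)
  also have "\<dots> = ?U + ?T - 2 * ?T"
    by (subst Bochner_Integration.integral_diff)
       (simp_all only: Bochner_Integration.integral_add[OF iu it] Bochner_Integration.integrable_add[OF iu it]
          integrable_mult_right[OF i] integral_mult_right_zero eq)
  finally show ?thesis by simp
qed

text \<open>
  A sum of mutually orthogonal projections is a projection. This reduces Bessel's inequality
  for a finite family to the contraction property of a single projection.
\<close>

lemma sum_projection_kernel:
  assumes F: "finite F"
    and P: "\<And>i. i \<in> F \<Longrightarrow> projection_kernel M (P i)"
    and orth: "\<And>i j x y. \<lbrakk>i \<in> F; j \<in> F; i \<noteq> j; x \<in> space M; y \<in> space M\<rbrakk>
        \<Longrightarrow> (\<integral>z. P i x z * P j z y \<partial>M) = 0"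
  shows "projection_kernel M (\<lambda>x y. \<Sum>i\<in>F. P i x y)"
  unfolding projection_kernel_def
proof (intro conjI ballI)
  have "(\<lambda>p. case p of (x, y) \<Rightarrow> P i x y) \<in> borel_measurable (M \<Otimes>\<^sub>M M)" if "i \<in> F" for i
    using projection_kernelD(1)[OF P[OF that]] .
  then have "(\<lambda>p. \<Sum>i\<in>F. case p of (x, y) \<Rightarrow> P i x y) \<in> borel_measurable (M \<Otimes>\<^sub>M M)"
    by (rule borel_measurable_sum)
  then show "(\<lambda>(x, y). \<Sum>i\<in>F. P i x y) \<in> borel_measurable (M \<Otimes>\<^sub>M M)"
    by (simp add: case_prod_beta')
  have "\<forall>i\<in>F. \<exists>C. \<forall>x\<in>space M. \<forall>y\<in>space M. cmod (P i x y) \<le> C"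
    using projection_kernelD(2)[OF P] by blast
  then obtain C where "\<And>i x y. i \<in> F \<Longrightarrow> x \<in> space M \<Longrightarrow> y \<in> space M \<Longrightarrow> cmod (P i x y) \<le> C i"
    by metis
  then show "\<exists>C. \<forall>x\<in>space M. \<forall>y\<in>space M. cmod (\<Sum>i\<in>F. P i x y) \<le> C"
    by (intro exI[of _ "\<Sum>i\<in>F. C i"] ballI sum_norm_le) auto
next
  fix x y assume xy: "x \<in> space M" "y \<in> space M"
  show "(\<Sum>i\<in>F. P i y x) = cnj (\<Sum>i\<in>F. P i x y)"
    using projection_kernelD(3)[OF P xy] by (auto simp: cnj_sum intro!: sum.cong)
  have "(\<integral>z. (\<Sum>i\<in>F. P i x z) * (\<Sum>j\<in>F. P j z y) \<partial>M)
      = (\<integral>z. (\<Sum>i\<in>F. \<Sum>j\<in>F. P i x z * P j z y) \<partial>M)"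
    by (simp add: sum_product)
  also have "\<dots> = (\<Sum>i\<in>F. \<Sum>j\<in>F. (\<integral>z. P i x z * P j z y \<partial>M))"
    using xy projection_kernel_slice[OF P]
    by (subst Bochner_Integration.integral_sum; (intro Bochner_Integration.integrable_sum
          L2_function_mult_integrable sum.cong Bochner_Integration.integral_sum)?) auto
  also have "\<dots> = (\<Sum>i\<in>F. \<Sum>j\<in>F. if i = j then P i x y else 0)"
    using xy orth projection_kernelD(4)[OF P xy] by (intro sum.cong) auto
  also have "\<dots> = (\<Sum>i\<in>F. P i x y)"
    using F by simp
  finally show "(\<integral>z. (\<Sum>i\<in>F. P i x z) * (\<Sum>j\<in>F. P j z y) \<partial>M) = (\<Sum>i\<in>F. P i x y)" .
qed

lemma integral_op_norm_square:
  assumes P: "projection_kernel M P" and u: "L2_function M u"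
  shows "complex_of_real (\<integral>x. (cmod (integral_op M P u x))\<^sup>2 \<partial>M) = (\<integral>x. integral_op M P u x * cnj (u x) \<partial>M)"
proof -
  have "complex_of_real (\<integral>x. (cmod (integral_op M P u x))\<^sup>2 \<partial>M)
      = (\<integral>x. integral_op M P u x * cnj (integral_op M P u x) \<partial>M)"
    by (simp add: complex_norm_square[symmetric] flip: integral_complex_of_real)
  then show ?thesis
    by (simp add: integral_op_inner[OF P u u])
qed

lemma bessel_projection_kernels:
  assumes F: "finite F"
    and P: "\<And>i. i \<in> F \<Longrightarrow> projection_kernel M (P i)"
    and orth: "\<And>i j x y. \<lbrakk>i \<in> F; j \<in> F; i \<noteq> j; x \<in> space M; y \<in> space M\<rbrakk>
        \<Longrightarrow> (\<integral>z. P i x z * P j z y \<partial>M) = 0"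
    and u: "L2_function M u"
  shows "(\<Sum>i\<in>F. \<integral>x. (cmod (integral_op M (P i) u x))\<^sup>2 \<partial>M) \<le> (\<integral>x. (cmod (u x))\<^sup>2 \<partial>M)"
proof -
  let ?E = "\<lambda>x y. \<Sum>i\<in>F. P i x y"
  have E: "projection_kernel M ?E"
    by (rule sum_projection_kernel[OF F P orth])
  have opE: "integral_op M ?E u x = (\<Sum>i\<in>F. integral_op M (P i) u x)" if x: "x \<in> space M" for x
    unfolding integral_op_def sum_distrib_right
    using x by (intro Bochner_Integration.integral_sum L2_function_mult_integrable projection_kernel_slice P u)
  have cu: "L2_function M (\<lambda>x. cnj (u x))"
    by (rule L2_function_cnj[OF u])
  have "complex_of_real (\<integral>x. (cmod (integral_op M ?E u x))\<^sup>2 \<partial>M) = (\<integral>x. integral_op M ?E u x * cnj (u x) \<partial>M)"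
    by (rule integral_op_norm_square[OF E u])
  also have "\<dots> = (\<integral>x. (\<Sum>i\<in>F. integral_op M (P i) u x * cnj (u x)) \<partial>M)"
    by (intro Bochner_Integration.integral_cong) (auto simp: opE sum_distrib_right)
  also have "\<dots> = (\<Sum>i\<in>F. \<integral>x. integral_op M (P i) u x * cnj (u x) \<partial>M)"
    by (intro Bochner_Integration.integral_sum L2_function_mult_integrable integral_op_L2 P u cu)
  also have "\<dots> = (\<Sum>i\<in>F. complex_of_real (\<integral>x. (cmod (integral_op M (P i) u x))\<^sup>2 \<partial>M))"
    by (intro sum.cong refl integral_op_norm_square[symmetric] P u)
  also have "\<dots> = complex_of_real (\<Sum>i\<in>F. \<integral>x. (cmod (integral_op M (P i) u x))\<^sup>2 \<partial>M)"
    by simp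
  finally have "(\<integral>x. (cmod (integral_op M ?E u x))\<^sup>2 \<partial>M)
      = (\<Sum>i\<in>F. \<integral>x. (cmod (integral_op M (P i) u x))\<^sup>2 \<partial>M)"
    by (simp only: of_real_eq_iff)
  then show ?thesis
    using integral_op_norm_le[OF E u] by simp
qed

text \<open>
  The pairing is \<open>\<langle>T u, cnj v\<rangle> = \<langle>T u, T (cnj v)\<rangle>\<close>; the rest is \<open>2 a b \<le> a\<^sup>2 + b\<^sup>2\<close> under the
  integral.
\<close>

lemma norm_integral_op_pairing_le:
  assumes P: "projection_kernel M P" and u: "L2_function M u" and v: "L2_function M v"
  shows "2 * cmod (\<integral>x. integral_op M P u x * v x \<partial>M) \<le>
    (\<integral>x. (cmod (integral_op M P u x))\<^sup>2 \<partial>M) + (\<integral>x. (cmod (integral_op M P (\<lambda>y. cnj (v y)) x))\<^sup>2 \<partial>M)"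
proof -
  let ?v = "\<lambda>y. cnj (v y)"
  let ?s = "integral_op M P u" and ?t = "integral_op M P ?v"
  have cv: "L2_function M ?v"
    by (rule L2_function_cnj[OF v])
  note s = integral_op_L2[OF P u] and t = integral_op_L2[OF P cv]
  have "(\<integral>x. ?s x * v x \<partial>M) = (\<integral>x. ?s x * cnj (?t x) \<partial>M)"
    using integral_op_inner[OF P u cv] by simp
  then have "cmod (\<integral>x. ?s x * v x \<partial>M) \<le> (\<integral>x. cmod (?s x * cnj (?t x)) \<partial>M)"
    by (simp only: integral_norm_bound)
  then have "2 * cmod (\<integral>x. ?s x * v x \<partial>M) \<le> (\<integral>x. 2 * cmod (?s x * cnj (?t x)) \<partial>M)"
    by simp
  also have "\<dots> \<le> (\<integral>x. (cmod (?s x))\<^sup>2 + (cmod (?t x))\<^sup>2 \<partial>M)"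
  proof (rule integral_mono)
    show "integrable M (\<lambda>x. 2 * cmod (?s x * cnj (?t x)))"
      by (intro integrable_mult_right integrable_norm L2_function_mult_integrable L2_function_cnj s t)
    show "integrable M (\<lambda>x. (cmod (?s x))\<^sup>2 + (cmod (?t x))\<^sup>2)"
      using s t by (auto simp: L2_function_def)
    show "2 * cmod (?s x * cnj (?t x)) \<le> (cmod (?s x))\<^sup>2 + (cmod (?t x))\<^sup>2" for x
      using sum_squares_bound[of "cmod (?s x)" "cmod (?t x)"] by (simp add: norm_mult mult.assoc)
  qed
  also have "\<dots> = (\<integral>x. (cmod (?s x))\<^sup>2 \<partial>M) + (\<integral>x. (cmod (?t x))\<^sup>2 \<partial>M)"
    using s t by (intro Bochner_Integration.integral_add) (auto simp: L2_function_def)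
  finally show ?thesis .
qed

lemma sum_norm_pairing_le:
  assumes F: "finite F"
    and P: "\<And>i. i \<in> F \<Longrightarrow> projection_kernel M (P i)"
    and orth: "\<And>i j x y. \<lbrakk>i \<in> F; j \<in> F; i \<noteq> j; x \<in> space M; y \<in> space M\<rbrakk>
        \<Longrightarrow> (\<integral>z. P i x z * P j z y \<partial>M) = 0"
    and u: "L2_function M u" and v: "L2_function M v"
  shows "2 * (\<Sum>i\<in>F. cmod (\<integral>x. integral_op M (P i) u x * v x \<partial>M)) \<le>
    (\<integral>x. (cmod (u x))\<^sup>2 \<partial>M) + (\<integral>x. (cmod (v x))\<^sup>2 \<partial>M)"
proof -
  let ?v = "\<lambda>y. cnj (v y)"
  have "2 * (\<Sum>i\<in>F. cmod (\<integral>x. integral_op M (P i) u x * v x \<partial>M)) \<le>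
    (\<Sum>i\<in>F. (\<integral>x. (cmod (integral_op M (P i) u x))\<^sup>2 \<partial>M) + (\<integral>x. (cmod (integral_op M (P i) ?v x))\<^sup>2 \<partial>M))"
    unfolding sum_distrib_left by (intro sum_mono norm_integral_op_pairing_le P u v)
  also have "\<dots> \<le> (\<integral>x. (cmod (u x))\<^sup>2 \<partial>M) + (\<integral>x. (cmod (?v x))\<^sup>2 \<partial>M)"
    unfolding sum.distrib
    by (intro add_mono bessel_projection_kernels[OF F P orth] u L2_function_cnj v)
  finally show ?thesis by simp
qed

lemma nn_integral_triple:
  fixes f :: "'a \<times> 'a \<Rightarrow> ennreal"
  assumes [measurable]: "f \<in> borel_measurable (M \<Otimes>\<^sub>M M)"
  shows "(\<integral>\<^sup>+(s, x, y). f (x, s) \<partial>(M \<Otimes>\<^sub>M (M \<Otimes>\<^sub>M M))) = (\<integral>\<^sup>+p. f p \<partial>(M \<Otimes>\<^sub>M M)) * emeasure M (space M)"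
    and "(\<integral>\<^sup>+(s, x, y). f (s, y) \<partial>(M \<Otimes>\<^sub>M (M \<Otimes>\<^sub>M M))) = (\<integral>\<^sup>+p. f p \<partial>(M \<Otimes>\<^sub>M M)) * emeasure M (space M)"
proof -
  interpret MM: pair_sigma_finite M M by standard
  have S: "sigma_finite_measure (M \<Otimes>\<^sub>M M)" ..
  have "(\<integral>\<^sup>+(s, x, y). f (x, s) \<partial>(M \<Otimes>\<^sub>M (M \<Otimes>\<^sub>M M))) = (\<integral>\<^sup>+s. \<integral>\<^sup>+(x, y). f (x, s) \<partial>(M \<Otimes>\<^sub>M M) \<partial>M)"
    by (simp add: sigma_finite_measure.nn_integral_fst [OF S, symmetric] case_prod_beta')
  also have "\<dots> = (\<integral>\<^sup>+s. \<integral>\<^sup>+x. \<integral>\<^sup>+y. f (x, s) \<partial>M \<partial>M \<partial>M)"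
  proof (rule nn_integral_cong)
    fix s assume [measurable]: "s \<in> space M"
    have "(\<lambda>(x, y). f (x, s)) \<in> borel_measurable (M \<Otimes>\<^sub>M M)"
      by measurable
    then show "(\<integral>\<^sup>+(x, y). f (x, s) \<partial>(M \<Otimes>\<^sub>M M)) = (\<integral>\<^sup>+x. \<integral>\<^sup>+y. f (x, s) \<partial>M \<partial>M)"
      by (simp add: nn_integral_fst [symmetric])
  qed
  also have "\<dots> = (\<integral>\<^sup>+s. \<integral>\<^sup>+x. f (x, s) \<partial>M \<partial>M) * emeasure M (space M)"
    by (simp add: nn_integral_multc cong: nn_integral_cong_simp)
  also have "(\<integral>\<^sup>+s. \<integral>\<^sup>+x. f (x, s) \<partial>M \<partial>M) = (\<integral>\<^sup>+p. f p \<partial>(M \<Otimes>\<^sub>M M))"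
    by (rule MM.nn_integral_snd) simp
  finally show "(\<integral>\<^sup>+(s, x, y). f (x, s) \<partial>(M \<Otimes>\<^sub>M (M \<Otimes>\<^sub>M M))) = (\<integral>\<^sup>+p. f p \<partial>(M \<Otimes>\<^sub>M M)) * emeasure M (space M)" .
  have "(\<integral>\<^sup>+(s, x, y). f (s, y) \<partial>(M \<Otimes>\<^sub>M (M \<Otimes>\<^sub>M M))) = (\<integral>\<^sup>+s. \<integral>\<^sup>+(x, y). f (s, y) \<partial>(M \<Otimes>\<^sub>M M) \<partial>M)"
    by (simp add: sigma_finite_measure.nn_integral_fst [OF S, symmetric] case_prod_beta')
  also have "\<dots> = (\<integral>\<^sup>+s. \<integral>\<^sup>+x. \<integral>\<^sup>+y. f (s, y) \<partial>M \<partial>M \<partial>M)"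
  proof (rule nn_integral_cong)
    fix s assume [measurable]: "s \<in> space M"
    have "(\<lambda>(x, y). f (s, y)) \<in> borel_measurable (M \<Otimes>\<^sub>M M)"
      by measurable
    then show "(\<integral>\<^sup>+(x, y). f (s, y) \<partial>(M \<Otimes>\<^sub>M M)) = (\<integral>\<^sup>+x. \<integral>\<^sup>+y. f (s, y) \<partial>M \<partial>M)"
      by (simp add: nn_integral_fst [symmetric])
  qed
  also have "\<dots> = (\<integral>\<^sup>+s. \<integral>\<^sup>+y. f (s, y) \<partial>M \<partial>M) * emeasure M (space M)"
    by (simp add: nn_integral_multc cong: nn_integral_cong_simp)
  also have "(\<integral>\<^sup>+s. \<integral>\<^sup>+y. f (s, y) \<partial>M \<partial>M) = (\<integral>\<^sup>+p. f p \<partial>(M \<Otimes>\<^sub>M M))"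
    by (rule nn_integral_fst) simp
  finally show "(\<integral>\<^sup>+(s, x, y). f (s, y) \<partial>(M \<Otimes>\<^sub>M (M \<Otimes>\<^sub>M M))) = (\<integral>\<^sup>+p. f p \<partial>(M \<Otimes>\<^sub>M M)) * emeasure M (space M)" .
qed

text \<open>
  A square integrable kernel enters the triple integral below with its two variables in
  different positions; the third variable only contributes the finite total mass.
\<close>

lemma integrable_triple:
  fixes g :: "'a \<Rightarrow> 'a \<Rightarrow> real"
  assumes g: "integrable (M \<Otimes>\<^sub>M M) (\<lambda>(x, y). g x y)"
  shows "integrable (M \<Otimes>\<^sub>M (M \<Otimes>\<^sub>M M)) (\<lambda>(s, x, y). g x s)"
    and "integrable (M \<Otimes>\<^sub>M (M \<Otimes>\<^sub>M M)) (\<lambda>(s, x, y). g s y)"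
proof -
  have [measurable]: "(\<lambda>(x, y). g x y) \<in> borel_measurable (M \<Otimes>\<^sub>M M)"
    using g by simp
  have m: "(\<lambda>(x, y). ennreal (norm (g x y))) \<in> borel_measurable (M \<Otimes>\<^sub>M M)"
    by measurable
  have fin: "(\<integral>\<^sup>+p. (case p of (x, y) \<Rightarrow> ennreal (norm (g x y))) \<partial>(M \<Otimes>\<^sub>M M)) * emeasure M (space M) < \<infinity>"
    using g by (auto simp: integrable_iff_bounded case_prod_beta' ennreal_mult_less_top emeasure_eq_measure)
  show "integrable (M \<Otimes>\<^sub>M (M \<Otimes>\<^sub>M M)) (\<lambda>(s, x, y). g x s)"
  proof (rule integrableI_bounded)
    show "(\<lambda>(s, x, y). g x s) \<in> borel_measurable (M \<Otimes>\<^sub>M (M \<Otimes>\<^sub>M M))"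
      by measurable
    show "(\<integral>\<^sup>+p. ennreal (norm (case p of (s, x, y) \<Rightarrow> g x s)) \<partial>(M \<Otimes>\<^sub>M (M \<Otimes>\<^sub>M M))) < \<infinity>"
      using nn_integral_triple(1)[OF m] fin by (simp add: case_prod_beta')
  qed
  show "integrable (M \<Otimes>\<^sub>M (M \<Otimes>\<^sub>M M)) (\<lambda>(s, x, y). g s y)"
  proof (rule integrableI_bounded)
    show "(\<lambda>(s, x, y). g s y) \<in> borel_measurable (M \<Otimes>\<^sub>M (M \<Otimes>\<^sub>M M))"
      by measurable
    show "(\<integral>\<^sup>+p. ennreal (norm (case p of (s, x, y) \<Rightarrow> g s y)) \<partial>(M \<Otimes>\<^sub>M (M \<Otimes>\<^sub>M M))) < \<infinity>"
      using nn_integral_triple(2)[OF m] fin by (simp add: case_prod_beta')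
  qed
qed

text \<open>
  Fubini moves the variable \<open>s\<close> of \<open>J J\<close> outside, so that for almost every \<open>s\<close> only the
  projection applied to one slice of \<open>J\<close>, paired with another slice, remains.
\<close>

lemma kernel_square_pairing:
  assumes P: "projection_kernel M P"
    and Jm: "(\<lambda>(x, y). J x y) \<in> borel_measurable (M \<Otimes>\<^sub>M M)"
    and J2: "integrable (M \<Otimes>\<^sub>M M) (\<lambda>(x, y). (cmod (J x y))\<^sup>2)"
  shows "integrable M (\<lambda>s. \<integral>y. integral_op M P (\<lambda>x. J x s) y * J s y \<partial>M)" (is ?int)
    and "(\<integral>(x, y). (\<integral>s. J x s * J s y \<partial>M) * cnj (P x y) \<partial>(M \<Otimes>\<^sub>M M))
       = (\<integral>s. \<integral>y. integral_op M P (\<lambda>x. J x s) y * J s y \<partial>M \<partial>M)" (is ?eq)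
proof -
  interpret MM: pair_sigma_finite M M by standard
  interpret MMM: pair_sigma_finite M "M \<Otimes>\<^sub>M M" by standard
  note Jm [measurable] projection_kernelD(1)[OF P, measurable]
  obtain C where C: "\<And>x y. x \<in> space M \<Longrightarrow> y \<in> space M \<Longrightarrow> cmod (P x y) \<le> C"
    using projection_kernelD(2)[OF P] by blast
  let ?G = "\<lambda>(s, x, y). J x s * J s y * P y x"
  have G: "integrable (M \<Otimes>\<^sub>M (M \<Otimes>\<^sub>M M)) ?G"
  proof (rule Bochner_Integration.integrable_bound)
    show "integrable (M \<Otimes>\<^sub>M (M \<Otimes>\<^sub>M M))
        (\<lambda>p. C * ((case p of (s, x, y) \<Rightarrow> (cmod (J x s))\<^sup>2) + (case p of (s, x, y) \<Rightarrow> (cmod (J s y))\<^sup>2)))"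
      by (intro integrable_mult_right Bochner_Integration.integrable_add
            integrable_triple[of "\<lambda>x y. (cmod (J x y))\<^sup>2"] J2)
    show "?G \<in> borel_measurable (M \<Otimes>\<^sub>M (M \<Otimes>\<^sub>M M))"
      by measurable
    show "AE p in M \<Otimes>\<^sub>M (M \<Otimes>\<^sub>M M). norm (?G p)
       \<le> norm (C * ((case p of (s, x, y) \<Rightarrow> (cmod (J x s))\<^sup>2) + (case p of (s, x, y) \<Rightarrow> (cmod (J s y))\<^sup>2)))"
    proof (rule AE_I2)
      fix p assume "p \<in> space (M \<Otimes>\<^sub>M (M \<Otimes>\<^sub>M M))"
      then obtain s x y where p: "p = (s, x, y)" and xy: "x \<in> space M" "y \<in> space M"
        by (auto simp: space_pair_measure)
      have C0: "0 \<le> C"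
        using C[OF xy] order_trans[OF norm_ge_zero] by blast
      have "2 * (cmod (J x s) * cmod (J s y)) \<le> (cmod (J x s))\<^sup>2 + (cmod (J s y))\<^sup>2"
        using sum_squares_bound[of "cmod (J x s)" "cmod (J s y)"] by (simp add: mult.assoc)
      moreover have "0 \<le> cmod (J x s) * cmod (J s y)"
        by simp
      ultimately have "cmod (J x s) * cmod (J s y) \<le> (cmod (J x s))\<^sup>2 + (cmod (J s y))\<^sup>2"
        by linarith
      then have "cmod (J x s) * cmod (J s y) * cmod (P y x) \<le> ((cmod (J x s))\<^sup>2 + (cmod (J s y))\<^sup>2) * C"
        using C[OF xy(2,1)] by (intro mult_mono) auto
      also have "\<dots> \<le> norm (C * ((cmod (J x s))\<^sup>2 + (cmod (J s y))\<^sup>2))"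
        by (simp add: mult.commute abs_le_iff)
      finally show "norm (?G p) \<le> norm (C * ((case p of (s, x, y) \<Rightarrow> (cmod (J x s))\<^sup>2) + (case p of (s, x, y) \<Rightarrow> (cmod (J s y))\<^sup>2)))"
        by (simp add: p norm_mult)
    qed
  qed
  have inner: "(\<integral>q. ?G (s, q) \<partial>(M \<Otimes>\<^sub>M M)) = (\<integral>y. integral_op M P (\<lambda>x. J x s) y * J s y \<partial>M)"
    if "integrable (M \<Otimes>\<^sub>M M) (\<lambda>q. ?G (s, q))" for s
  proof -
    have "(\<integral>q. ?G (s, q) \<partial>(M \<Otimes>\<^sub>M M)) = (\<integral>y. \<integral>x. J x s * J s y * P y x \<partial>M \<partial>M)"
      using MM.integral_snd[of "\<lambda>x y. J x s * J s y * P y x"] that by simp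
    also have "\<dots> = (\<integral>y. \<integral>x. J s y * (P y x * J x s) \<partial>M \<partial>M)"
      by (simp add: mult_ac)
    finally show ?thesis
      by (simp add: integral_op_def mult.commute)
  qed
  have AEs: "AE s in M. (\<integral>q. ?G (s, q) \<partial>(M \<Otimes>\<^sub>M M)) = (\<integral>y. integral_op M P (\<lambda>x. J x s) y * J s y \<partial>M)"
    using MMM.AE_integrable_fst'[OF G] by eventually_elim (rule inner)
  have m: "(\<lambda>s. \<integral>y. integral_op M P (\<lambda>x. J x s) y * J s y \<partial>M) \<in> borel_measurable M"
    unfolding integral_op_def by measurable
  show ?int
    using MMM.integrable_fst'[OF G] AEs m
    by (subst integrable_cong_AE[OF _ _ AEs, symmetric]) auto
  have "(\<integral>(x, y). (\<integral>s. J x s * J s y \<partial>M) * cnj (P x y) \<partial>(M \<Otimes>\<^sub>M M))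
      = (\<integral>q. \<integral>s. ?G (s, q) \<partial>M \<partial>(M \<Otimes>\<^sub>M M))"
  proof (rule Bochner_Integration.integral_cong)
    fix q assume "q \<in> space (M \<Otimes>\<^sub>M M)"
    then obtain x y where q: "q = (x, y)" and xy: "x \<in> space M" "y \<in> space M"
      by (auto simp: space_pair_measure)
    show "(case q of (x, y) \<Rightarrow> (\<integral>s. J x s * J s y \<partial>M) * cnj (P x y)) = (\<integral>s. ?G (s, q) \<partial>M)"
      by (simp add: q projection_kernelD(3)[OF P xy])
  qed simp
  also have "\<dots> = (\<integral>s. \<integral>q. ?G (s, q) \<partial>(M \<Otimes>\<^sub>M M) \<partial>M)"
    using MMM.Fubini_integral[of "\<lambda>s q. ?G (s, q)"] G by simp
  also have "\<dots> = (\<integral>s. \<integral>y. integral_op M P (\<lambda>x. J x s) y * J s y \<partial>M \<partial>M)"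
    using m MMM.integrable_fst'[OF G] by (intro integral_cong_AE AEs) auto
  finally show ?eq .
qed

text \<open>
  The trace estimate described at the beginning: for almost every \<open>s\<close> both slices of \<open>J\<close> at
  \<open>s\<close> are square integrable, and integrating their squared norms over \<open>s\<close> gives \<open>\<parallel>J\<parallel>\<^sup>2\<close> twice.
\<close>

lemma sum_kernel_square_pairing_le:
  assumes F: "finite F"
    and P: "\<And>i. i \<in> F \<Longrightarrow> projection_kernel M (P i)"
    and orth: "\<And>i j x y. \<lbrakk>i \<in> F; j \<in> F; i \<noteq> j; x \<in> space M; y \<in> space M\<rbrakk>
        \<Longrightarrow> (\<integral>z. P i x z * P j z y \<partial>M) = 0"
    and Jm: "(\<lambda>(x, y). J x y) \<in> borel_measurable (M \<Otimes>\<^sub>M M)"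
    and J2: "integrable (M \<Otimes>\<^sub>M M) (\<lambda>(x, y). (cmod (J x y))\<^sup>2)"
  shows "(\<Sum>i\<in>F. cmod (\<integral>(x, y). (\<integral>s. J x s * J s y \<partial>M) * cnj (P i x y) \<partial>(M \<Otimes>\<^sub>M M)))
       \<le> (\<integral>(x, y). (cmod (J x y))\<^sup>2 \<partial>(M \<Otimes>\<^sub>M M))"
proof -
  interpret MM: pair_sigma_finite M M by standard
  note Jm [measurable]
  let ?t = "\<lambda>i s. \<integral>y. integral_op M (P i) (\<lambda>x. J x s) y * J s y \<partial>M"
  let ?a = "\<lambda>s. \<integral>x. (cmod (J x s))\<^sup>2 \<partial>M" and ?b = "\<lambda>s. \<integral>y. (cmod (J s y))\<^sup>2 \<partial>M"
  have int_t: "integrable M (?t i)" if "i \<in> F" for i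
    by (rule kernel_square_pairing(1)[OF P[OF that] Jm J2])
  have ab: "integrable M ?a" "integrable M ?b"
    using MM.integrable_snd[OF J2] MM.integrable_fst[OF J2] by auto
  have "(\<Sum>i\<in>F. cmod (\<integral>(x, y). (\<integral>s. J x s * J s y \<partial>M) * cnj (P i x y) \<partial>(M \<Otimes>\<^sub>M M)))
      = (\<Sum>i\<in>F. cmod (\<integral>s. ?t i s \<partial>M))"
    using kernel_square_pairing(2)[OF P Jm J2] by (intro sum.cong) auto
  also have "\<dots> \<le> (\<Sum>i\<in>F. \<integral>s. cmod (?t i s) \<partial>M)"
    by (intro sum_mono integral_norm_bound)
  also have "\<dots> = (\<integral>s. (\<Sum>i\<in>F. cmod (?t i s)) \<partial>M)"
    using int_t by (intro Bochner_Integration.integral_sum[symmetric] integrable_norm)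
  also have "\<dots> \<le> (\<integral>s. (?a s + ?b s) / 2 \<partial>M)"
  proof (rule integral_mono_AE)
    show "integrable M (\<lambda>s. \<Sum>i\<in>F. cmod (?t i s))"
      using int_t by (intro Bochner_Integration.integrable_sum integrable_norm)
    show "integrable M (\<lambda>s. (?a s + ?b s) / 2)"
      using ab by auto
    have "AE s in M. integrable M (\<lambda>x. (cmod (J x s))\<^sup>2)" "AE s in M. integrable M (\<lambda>y. (cmod (J s y))\<^sup>2)"
      using MM.AE_integrable_snd[OF J2] MM.AE_integrable_fst[OF J2] by auto
    moreover have "AE s in M. s \<in> space M"
      by (rule AE_space)
    ultimately show "AE s in M. (\<Sum>i\<in>F. cmod (?t i s)) \<le> (?a s + ?b s) / 2"
    proof eventually_elim
      case (elim s)
      have u: "L2_function M (\<lambda>x. J x s)" and v: "L2_function M (J s)"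
        using elim by (auto simp: L2_function_def)
      show ?case
        using sum_norm_pairing_le[where P = P, OF F P orth u v] by simp
    qed
  qed
  also have "\<dots> = (\<integral>(x, y). (cmod (J x y))\<^sup>2 \<partial>(M \<Otimes>\<^sub>M M))"
    using ab MM.integral_snd[OF J2] MM.integral_fst[OF J2] by simp
  finally show ?thesis .
qed

end

section \<open>Unitarily invariant averages over the sphere\<close>

lemma cinner_add_left: "cinner (x + y) z = cinner x z + cinner y z"
  by (simp add: cinner_def algebra_simps sum.distrib)

lemma cinner_add_right: "cinner z (x + y) = cinner z x + cinner z y"
  by (simp add: cinner_def algebra_simps sum.distrib)

lemma cinner_diff_left: "cinner (x - y) z = cinner x z - cinner y z"
  by (simp add: cinner_def algebra_simps sum_subtractf)

lemma cinner_diff_right: "cinner z (x - y) = cinner z x - cinner z y"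
  by (simp add: cinner_def algebra_simps sum_subtractf)

lemma cinner_smult_left: "cinner (c *s x) y = c * cinner x y"
  by (simp add: cinner_def sum_distrib_left mult.assoc)

lemma cinner_smult_right: "cinner x (c *s y) = cnj c * cinner x y"
  by (simp add: cinner_def sum_distrib_left mult_ac)

lemma cnj_cinner: "cnj (cinner x y) = cinner y x"
  by (simp add: cinner_def mult.commute)

lemmas cinner_simps = cinner_add_left cinner_add_right cinner_diff_left cinner_diff_right
  cinner_smult_left cinner_smult_right

lemma cinner_self: "cinner x x = complex_of_real ((norm x)\<^sup>2)"
  by (simp add: cinner_def complex_norm_square[symmetric] norm_vec_def L2_set_def sum_nonneg
      flip: of_real_sum of_real_power)

lemma cinner_self_sphere: "x \<in> sphere 0 1 \<Longrightarrow> cinner x x = 1"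
  by (simp add: cinner_self)

lemma Re_cinner: "Re (cinner x y) = x \<bullet> y"
  by (simp add: cinner_def inner_vec_def inner_complex_def)

lemma cinner_axis: "cinner x (axis i 1) = x $ i"
  by (simp add: cinner_def axis_def if_distrib[where f=cnj] if_distrib[where f="\<lambda>c. _ * c"] cong: if_cong)

lemma continuous_on_cinner [continuous_intros]:
  fixes f g :: "'a::topological_space \<Rightarrow> complex ^ 'q::finite"
  shows "continuous_on S f \<Longrightarrow> continuous_on S g \<Longrightarrow> continuous_on S (\<lambda>x. cinner (f x) (g x))"
  unfolding cinner_def by (intro continuous_intros)

definition sphere_avg :: "(complex ^ 'q::finite \<Rightarrow> complex) \<Rightarrow> complex" where
  "sphere_avg f = (\<integral>x. f x \<partial>surface_measure) / complex_of_real (sphere_area CARD('q))"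

lemma sphere_area_pos: "sphere_area q > 0"
  by (simp add: sphere_area_def)

lemma sphere_continuous_integrable:
  fixes f :: "complex ^ 'q::finite \<Rightarrow> complex"
  assumes f: "continuous_on UNIV f"
  shows "integrable surface_measure f"
proof -
  interpret finite_measure "surface_measure :: (complex ^ 'q) measure"
    by (rule finite_measure_surface_measure)
  have "compact (f ` sphere 0 1)"
    by (intro compact_continuous_image continuous_on_subset[OF f] compact_sphere) auto
  then obtain B where "\<And>x. x \<in> sphere 0 1 \<Longrightarrow> norm (f x) \<le> B"
    by (metis bounded_iff compact_imp_bounded imageI)
  moreover have "f \<in> borel_measurable surface_measure"
    using borel_measurable_continuous_onI[OF f] measurable_restrict_space1
    by (subst measurable_cong_sets[OF sets_surface_measure refl]) auto
  ultimately show ?thesis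
    by (intro integrable_const_bound[where B = B] AE_I2) auto
qed

lemma sphere_avg_cong:
  "(\<And>x. x \<in> sphere 0 1 \<Longrightarrow> f x = g x) \<Longrightarrow> sphere_avg f = sphere_avg g"
  unfolding sphere_avg_def
  by (intro arg_cong2[where f = "(/)"] Bochner_Integration.integral_cong) auto

lemma sphere_avg_const [simp]: "sphere_avg (\<lambda>x :: complex ^ 'q::finite. c) = c"
proof -
  have "measure surface_measure (sphere (0 :: complex ^ 'q) 1) = sphere_area CARD('q)"
    using sphere_area_pos[of "CARD('q)"] by (simp add: measure_def emeasure_surface_measure_sphere)
  then show ?thesis
    using sphere_area_pos[of "CARD('q)"]
    by (simp add: sphere_avg_def scaleR_conv_of_real)
qed

lemma sphere_avg_cmult: "sphere_avg (\<lambda>x. c * f x) = c * sphere_avg f"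
  by (simp add: sphere_avg_def)

lemma sphere_avg_cnj: "sphere_avg (\<lambda>x. cnj (f x)) = cnj (sphere_avg f)"
  by (simp add: sphere_avg_def)

lemma sphere_avg_diff:
  assumes "continuous_on UNIV f" "continuous_on UNIV g"
  shows "sphere_avg (\<lambda>x. f x - g x) = sphere_avg f - sphere_avg g"
  using assms by (simp add: sphere_avg_def sphere_continuous_integrable diff_divide_distrib)

lemma sphere_avg_sum:
  assumes "\<And>i. i \<in> I \<Longrightarrow> continuous_on UNIV (f i)"
  shows "sphere_avg (\<lambda>x. \<Sum>i\<in>I. f i x) = (\<Sum>i\<in>I. sphere_avg (f i))"
  using assms by (simp add: sphere_avg_def sphere_continuous_integrable sum_divide_distrib)

text \<open>
  In finite dimension these are exactly the unitary operators, since preserving the Hermitian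
  product makes a real linear map complex linear. Real linearity is the form that makes \<open>\<rho>\<close> an
  orthogonal transformation.
\<close>

definition unitary_map :: "(complex ^ 'q \<Rightarrow> complex ^ 'q) \<Rightarrow> bool" where
  "unitary_map \<rho> \<longleftrightarrow> linear \<rho> \<and> (\<forall>x y. cinner (\<rho> x) (\<rho> y) = cinner x y)"

lemma sphere_avg_unitary:
  fixes \<rho> :: "complex ^ 'q::finite \<Rightarrow> complex ^ 'q"
  assumes \<rho>: "unitary_map \<rho>" and f: "continuous_on UNIV f"
  shows "sphere_avg (\<lambda>x. f (\<rho> x)) = sphere_avg f"
proof -
  have "orthogonal_transformation \<rho>"
    using \<rho> unfolding unitary_map_def orthogonal_transformation_def
    by (metis Re_cinner)
  note inv = surface_measure_distr_orthogonal[OF this]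
  have "(\<integral>x. f x \<partial>surface_measure) = (\<integral>x. f x \<partial>distr surface_measure surface_measure \<rho>)"
    by (simp add: inv(2))
  also have "\<dots> = (\<integral>x. f (\<rho> x) \<partial>surface_measure)"
    by (rule integral_distr[OF inv(1)]) (rule borel_measurable_integrable[OF sphere_continuous_integrable[OF f]])
  finally show ?thesis
    by (simp add: sphere_avg_def)
qed

text \<open>
  The way in which symmetry is used to annihilate averages: a function that a unitary map
  multiplies by a constant other than \<open>1\<close>.
\<close>

lemma sphere_avg_eq_0:
  fixes \<rho> :: "complex ^ 'q::finite \<Rightarrow> complex ^ 'q"
  assumes \<rho>: "unitary_map \<rho>" and f: "continuous_on UNIV f"
    and c: "\<And>x. f (\<rho> x) = c * f x" "c \<noteq> 1"
  shows "sphere_avg f = 0"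
proof -
  have "sphere_avg f = c * sphere_avg f"
    using sphere_avg_unitary[OF \<rho> f] by (simp add: c sphere_avg_cmult)
  then show ?thesis
    using c(2) by simp
qed

lemma linear_cinner_left: "linear (\<lambda>x. cinner x a)"
  by (rule linearI) (auto simp: cinner_def algebra_simps sum.distrib scaleR_sum_right)

lemma linear_smult: "linear (\<lambda>x :: complex ^ 'q::finite. c *s x)"
  by (rule linearI) (auto simp: vec_eq_iff algebra_simps)

lemma linear_cinner_smult: "linear (\<lambda>x. cinner x a *s b)"
  by (rule linearI)
     (auto simp: vec_eq_iff algebra_simps linear_add[OF linear_cinner_left] linear_scale[OF linear_cinner_left])

lemma unitary_scalar:
  assumes "cmod c = 1"
  shows "unitary_map (\<lambda>x. c *s x)"
proof -
  have "c * cnj c = 1"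
    using assms by (simp add: complex_norm_square[symmetric])
  then have "cnj c * (c * z) = z" for z
    by (metis mult.assoc mult.commute mult_1)
  then show ?thesis
    unfolding unitary_map_def cinner_smult_left cinner_smult_right by (simp only: linear_smult simp_thms)
qed

text \<open>
  Multiplication by \<open>c\<close> on the orthogonal complement of \<open>x\<close>, and the identity on the line
  through \<open>x\<close>.
\<close>

lemma unitary_rotate_complement:
  assumes x: "x \<in> sphere 0 1" and c: "cmod c = 1"
  shows "unitary_map (\<lambda>\<xi>. c *s \<xi> + (1 - c) *s (cinner \<xi> x *s x))"
proof -
  have "linear (\<lambda>\<xi>. c *s \<xi> + (1 - c) *s (cinner \<xi> x *s x))"
    using linear_compose_add[OF linear_smult linear_compose[OF linear_cinner_smult linear_smult]]
    by (simp add: o_def)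
  moreover have "c * cnj c = 1"
    using c by (simp add: complex_norm_square[symmetric])
  then have cc: "c * (cnj c * z) = z" for z
    by (metis mult.assoc mult_1)
  have "cinner (c *s a + (1 - c) *s (cinner a x *s x)) (c *s b + (1 - c) *s (cinner b x *s x)) = cinner a b" for a b
    using x by (simp add: cinner_simps cinner_self_sphere cnj_cinner algebra_simps cc)
  ultimately show ?thesis
    by (simp only: unitary_map_def) blast
qed

text \<open>
  For \<open>x \<noteq> y\<close> put \<open>v = x - y\<close>. The complex reflection along \<open>v\<close> that maps \<open>x\<close> to \<open>y\<close> is
  \<open>\<xi> \<mapsto> \<xi> - (\<xi> \<cdot> v) / (x \<cdot> v) v\<close>; it is unitary because \<open>v \<cdot> v\<close> is twice the real part of
  \<open>x \<cdot> v\<close>.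
\<close>

lemma unitary_transitive:
  assumes x: "x \<in> sphere 0 1" and y: "y \<in> sphere 0 1"
  shows "\<exists>\<rho>. unitary_map \<rho> \<and> \<rho> x = (y :: complex ^ 'q::finite)"
proof (cases "x = y")
  case True
  have "unitary_map (\<lambda>x :: complex ^ 'q. x)"
    by (simp add: unitary_map_def linear_id[unfolded id_def])
  then show ?thesis
    using True by blast
next
  case False
  define s where "s = 1 - cinner x y"
  define v where "v = x - y"
  have s0: "s \<noteq> 0"
  proof
    assume "s = 0"
    then have "x \<bullet> y = 1"
      by (metis Re_cinner eq_iff_diff_eq_0 one_complex.sel(1) s_def)
    moreover have "x \<bullet> x = 1" "y \<bullet> y = 1"
      using x y by (simp_all flip: power2_norm_eq_inner)
    ultimately have "(norm (x - y))\<^sup>2 = 0"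
      by (simp add: power2_norm_eq_inner inner_diff inner_commute)
    with False show False by simp
  qed
  have vv: "cinner v v = s + cnj s"
    using x y by (simp add: v_def s_def cinner_simps cinner_self_sphere cnj_cinner)
  have xv: "cinner x v = s"
    using x y by (simp add: v_def s_def cinner_simps cinner_self_sphere)
  define r where "r = 1 / s"
  have rs: "r * s = 1" "cnj r * cnj s = 1"
    using s0 by (auto simp: r_def)
  let ?\<rho> = "\<lambda>\<xi>. \<xi> - r *s (cinner \<xi> v *s v)"
  have lin: "linear ?\<rho>"
    by (intro linear_compose_sub linear_id[unfolded id_def]
        linear_compose[OF linear_cinner_smult linear_smult, unfolded o_def])
  have "cinner (?\<rho> a) (?\<rho> b) = cinner a b" for a b
  proof -
    have "cinner (?\<rho> a) (?\<rho> b) = cinner a b - r * (cinner a v * cinner v b)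
        - (cnj r * (cinner v b * cinner a v) - cnj r * (cinner v b * (r * (cinner a v * (s + cnj s)))))"
      by (simp only: cinner_diff_left cinner_diff_right cinner_smult_left cinner_smult_right cnj_cinner
          complex_cnj_mult vv right_diff_distrib)
    also have "cnj r * (cinner v b * (r * (cinner a v * (s + cnj s)))) =
        (r * s) * (cnj r * (cinner v b * cinner a v)) + (cnj r * cnj s) * (r * (cinner a v * cinner v b))"
      by (simp only: algebra_simps)
    finally show ?thesis
      by (simp only: rs) simp
  qed
  moreover have "?\<rho> x = y"
  proof -
    have "r *s (s *s v) = v"
      by (simp only: vector_smult_assoc rs vector_smult_lid)
    then show ?thesis
      by (simp only: xv) (simp add: v_def)
  qed
  ultimately show ?thesis
    using lin unfolding unitary_map_def by blast
qed

section \<open>Moments of the sphere\<close>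

lemma cinner_axis_left: "cinner (axis i 1) x = cnj (x $ i)"
  by (metis cnj_cinner cinner_axis)

text \<open>
  The unit scalar by which \<open>sphere_avg_off_diagonal\<close> and \<open>sphere_avg_homogeneous_eq_0\<close> tell
  different exponents apart.
\<close>

lemma ex_unit_power_eq_minus_one:
  assumes st: "s \<noteq> t"
  shows "\<exists>c. cmod c = 1 \<and> c ^ s * cnj c ^ t = -1"
proof -
  \<comment> \<open>The angle is chosen to make the total rotation by \<open>s - t\<close> steps a half turn.\<close>
  define c where "c = cis (pi / (real s - real t))"
  have cst: "c ^ s * cnj c ^ t = -1"
  proof -
    have "c ^ s * cnj c ^ t = cis (real s * (pi / (real s - real t)) + real t * (- (pi / (real s - real t))))"
      by (simp only: c_def cis_cnj Complex.DeMoivre cis_mult)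
    also have "real s * (pi / (real s - real t)) + real t * (- (pi / (real s - real t))) = pi"
    proof -
      have "real s * z + real t * (- z) = (real s - real t) * z" for z
        by (simp add: algebra_simps)
      note this[of "pi / (real s - real t)"]
      also have "(real s - real t) * (pi / (real s - real t)) = pi"
        using st by simp
      finally show ?thesis .
    qed
    finally show ?thesis by (simp only: cis_pi)
  qed
  moreover have "cmod c = 1"
    by (simp add: c_def)
  ultimately show ?thesis by blast
qed

text \<open>
  Rotating the complement of \<open>x\<close> by \<open>c\<close> fixes \<open>x \<cdot> \<xi>\<close> and multiplies the product of powers by
  \<open>c\<^bsup>s\<^esup> cnj c\<^bsup>t\<^esup>\<close>.
\<close>

lemma sphere_avg_off_diagonal:
  fixes x y :: "complex ^ 'q::finite"
  assumes x: "x \<in> sphere 0 1" and xy: "cinner x y = 0" and \<Phi>: "continuous_on UNIV \<Phi>" and st: "s \<noteq> t"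
  shows "sphere_avg (\<lambda>\<xi>. \<Phi> (cinner x \<xi>) * (cinner \<xi> y ^ s * cinner y \<xi> ^ t)) = 0"
proof -
  obtain c where c: "cmod c = 1" and cst: "c ^ s * cnj c ^ t = -1"
    using ex_unit_power_eq_minus_one[OF st] by blast
  have yx: "cinner y x = 0"
    using xy by (metis cnj_cinner complex_cnj_zero)
  let ?\<rho> = "\<lambda>\<xi>. c *s \<xi> + (1 - c) *s (cinner \<xi> x *s x)"
  have \<rho>: "unitary_map ?\<rho>"
    by (rule unitary_rotate_complement[OF x c])
  have 1: "cinner x (?\<rho> \<xi>) = cinner x \<xi>" "cinner (?\<rho> \<xi>) y = c * cinner \<xi> y" "cinner y (?\<rho> \<xi>) = cnj c * cinner y \<xi>" for \<xi>
    by (simp_all add: cinner_simps cinner_self_sphere[OF x] cnj_cinner xy yx algebra_simps)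
  show ?thesis
  proof (rule sphere_avg_eq_0[OF \<rho>])
    show "continuous_on UNIV (\<lambda>\<xi>. \<Phi> (cinner x \<xi>) * (cinner \<xi> y ^ s * cinner y \<xi> ^ t))"
      by (intro continuous_intros continuous_on_compose2[OF \<Phi>]) auto
    fix \<xi>
    have "\<Phi> (cinner x (?\<rho> \<xi>)) * (cinner (?\<rho> \<xi>) y ^ s * cinner y (?\<rho> \<xi>) ^ t)
      = (c ^ s * cnj c ^ t) * (\<Phi> (cinner x \<xi>) * (cinner \<xi> y ^ s * cinner y \<xi> ^ t))"
      by (simp only: 1 power_mult_distrib mult_ac)
    then show "\<Phi> (cinner x (?\<rho> \<xi>)) * (cinner (?\<rho> \<xi>) y ^ s * cinner y (?\<rho> \<xi>) ^ t)
      = (- 1) * (\<Phi> (cinner x \<xi>) * (cinner \<xi> y ^ s * cinner y \<xi> ^ t))"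
      by (simp only: cst)
  qed simp
qed

text \<open>
  Binomial expansion along \<open>y = a x + y'\<close>. Of the double sum only the diagonal \<open>i = l + d\<close>
  survives, where the exponents of \<open>\<xi> \<cdot> y'\<close> and \<open>y' \<cdot> \<xi>\<close> agree.
\<close>

lemma sphere_avg_expand:
  fixes x y' :: "complex ^ 'q::finite"
  assumes x: "x \<in> sphere 0 1" and xy: "cinner x y' = 0" and \<Phi>: "continuous_on UNIV \<Phi>"
    and y: "y = a *s x + y'"
  shows "sphere_avg (\<lambda>\<xi>. \<Phi> (cinner x \<xi>) * (cinner \<xi> y ^ (b + d) * cinner y \<xi> ^ b)) =
    (\<Sum>l\<le>b. of_nat ((b + d) choose (l + d)) * of_nat (b choose l) * cnj a ^ (l + d) * a ^ l *
      sphere_avg (\<lambda>\<xi>. \<Phi> (cinner x \<xi>) * (cinner \<xi> x ^ (l + d) * cinner x \<xi> ^ l)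
          * (cinner \<xi> y' * cinner y' \<xi>) ^ (b - l)))"
proof -
  let ?\<Psi> = "\<lambda>i l z. \<Phi> z * (cnj z ^ i * z ^ l)"
  have \<Psi>: "continuous_on UNIV (?\<Psi> i l)" for i l
    by (intro continuous_intros \<Phi>)
  let ?T = "\<lambda>i l \<xi>. ?\<Psi> i l (cinner x \<xi>) * (cinner \<xi> y' ^ (b + d - i) * cinner y' \<xi> ^ (b - l))"
  let ?c = "\<lambda>i l. of_nat ((b + d) choose i) * of_nat (b choose l) * cnj a ^ i * a ^ l :: complex"
  have T: "continuous_on UNIV (?T i l)" for i l
    by (intro continuous_intros continuous_on_compose2[OF \<Phi>]) auto
  have "\<Phi> (cinner x \<xi>) * (cinner \<xi> y ^ (b + d) * cinner y \<xi> ^ b) = (\<Sum>l\<le>b. \<Sum>i\<le>b+d. ?c i l * ?T i l \<xi>)" for \<xi>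
  proof -
    have e: "cinner \<xi> y = cnj a * cinner \<xi> x + cinner \<xi> y'" "cinner y \<xi> = a * cinner x \<xi> + cinner y' \<xi>"
      by (simp_all add: y cinner_simps)
    have "cinner \<xi> y ^ (b + d) * cinner y \<xi> ^ b = (\<Sum>i\<le>b+d. \<Sum>l\<le>b.
        (of_nat ((b + d) choose i) * (cnj a * cinner \<xi> x) ^ i * cinner \<xi> y' ^ (b + d - i)) *
        (of_nat (b choose l) * (a * cinner x \<xi>) ^ l * cinner y' \<xi> ^ (b - l)))"
      unfolding e binomial_ring sum_product ..
    also have "\<dots> = (\<Sum>l\<le>b. \<Sum>i\<le>b+d.
        (of_nat ((b + d) choose i) * (cnj a * cinner \<xi> x) ^ i * cinner \<xi> y' ^ (b + d - i)) *
        (of_nat (b choose l) * (a * cinner x \<xi>) ^ l * cinner y' \<xi> ^ (b - l)))"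
      by (rule sum.swap)
    finally have "\<Phi> (cinner x \<xi>) * (cinner \<xi> y ^ (b + d) * cinner y \<xi> ^ b) = (\<Sum>l\<le>b. \<Sum>i\<le>b+d. \<Phi> (cinner x \<xi>) *
        ((of_nat ((b + d) choose i) * (cnj a * cinner \<xi> x) ^ i * cinner \<xi> y' ^ (b + d - i)) *
        (of_nat (b choose l) * (a * cinner x \<xi>) ^ l * cinner y' \<xi> ^ (b - l))))"
      by (simp only: sum_distrib_left)
    also have "\<dots> = (\<Sum>l\<le>b. \<Sum>i\<le>b+d. ?c i l * ?T i l \<xi>)"
      by (intro sum.cong refl) (simp only: cnj_cinner power_mult_distrib mult_ac)
    finally show ?thesis .
  qed
  then have "sphere_avg (\<lambda>\<xi>. \<Phi> (cinner x \<xi>) * (cinner \<xi> y ^ (b + d) * cinner y \<xi> ^ b))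
      = sphere_avg (\<lambda>\<xi>. \<Sum>l\<le>b. \<Sum>i\<le>b+d. ?c i l * ?T i l \<xi>)"
    by presburger
  also have "\<dots> = (\<Sum>l\<le>b. sphere_avg (\<lambda>\<xi>. \<Sum>i\<le>b+d. ?c i l * ?T i l \<xi>))"
    by (rule sphere_avg_sum) (intro continuous_on_sum continuous_on_mult continuous_on_const T)
  also have "\<dots> = (\<Sum>l\<le>b. \<Sum>i\<le>b+d. sphere_avg (\<lambda>\<xi>. ?c i l * ?T i l \<xi>))"
    by (intro sum.cong refl sphere_avg_sum continuous_on_mult continuous_on_const T)
  also have "\<dots> = (\<Sum>l\<le>b. \<Sum>i\<le>b+d. if i = l + d then ?c i l * sphere_avg (?T i l) else 0)"
  proof (intro sum.cong refl)
    fix l i assume "l \<in> {..b}" "i \<in> {..b+d}"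
    then have "b + d - i \<noteq> b - l" if "i \<noteq> l + d"
      using that by auto
    then have "sphere_avg (?T i l) = 0" if "i \<noteq> l + d"
      using that by (intro sphere_avg_off_diagonal[OF x xy \<Psi>])
    then show "sphere_avg (\<lambda>\<xi>. ?c i l * ?T i l \<xi>) = (if i = l + d then ?c i l * sphere_avg (?T i l) else 0)"
      by (simp only: sphere_avg_cmult split: if_splits) simp
  qed
  also have "\<dots> = (\<Sum>l\<le>b. ?c (l + d) l * sphere_avg (?T (l + d) l))"
    by (intro sum.cong refl) simp
  also have "\<dots> = (\<Sum>l\<le>b. of_nat ((b + d) choose (l + d)) * of_nat (b choose l) * cnj a ^ (l + d) * a ^ l *
      sphere_avg (\<lambda>\<xi>. \<Phi> (cinner x \<xi>) * (cinner \<xi> x ^ (l + d) * cinner x \<xi> ^ l)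
          * (cinner \<xi> y' * cinner y' \<xi>) ^ (b - l)))"
    by (intro sum.cong refl) (simp only: cnj_cinner power_mult_distrib add_diff_cancel_right diff_add_inverse2 diff_diff_add add.commute)
  finally show ?thesis .
qed

text \<open>
  The index \<open>undefined\<close> is an arbitrary coordinate; by transitivity of the unitary maps all
  unit vectors have the same moments.
\<close>

definition axis_moment :: "'q::finite itself \<Rightarrow> nat \<Rightarrow> complex" where
  "axis_moment _ N = sphere_avg (\<lambda>\<xi> :: complex ^ 'q. (cinner \<xi> (axis undefined 1) * cinner (axis undefined 1) \<xi>) ^ N)"

lemma sphere_avg_power_cinner:
  fixes z :: "complex ^ 'q::finite"
  shows "sphere_avg (\<lambda>\<xi>. (cinner \<xi> z * cinner z \<xi>) ^ N) = complex_of_real ((norm z)\<^sup>2) ^ N * axis_moment TYPE('q) N"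
proof -
  let ?e = "axis undefined 1 :: complex ^ 'q"
  \<comment> \<open>For \<open>z = 0\<close> any unit vector will do.\<close>
  obtain u where u: "u \<in> sphere 0 1" "z = complex_of_real (norm z) *s u"
  proof (cases "z = 0")
    case True
    then show ?thesis using that[of ?e] by (simp add: norm_axis_1)
  next
    case False
    have "complex_of_real (norm z) *s ((1 / complex_of_real (norm z)) *s z) = z"
      using False by (simp add: vector_smult_assoc)
    moreover have "norm ((1 / complex_of_real (norm z)) *s z) = 1"
    proof -
      have "(1 / complex_of_real (norm z)) *s z = (1 / norm z) *\<^sub>R z"
        by (simp add: vec_eq_iff scaleR_conv_of_real[where 'a = complex])
      then show ?thesis using False by simp
    qed
    ultimately show ?thesis using that by auto
  qed
  obtain \<rho> where \<rho>: "unitary_map \<rho>" "\<rho> ?e = u"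
    using unitary_transitive[of ?e u] u by (auto simp: norm_axis_1)
  have \<rho>i: "cinner (\<rho> a) (\<rho> b) = cinner a b" for a b
    using \<rho>(1) by (simp add: unitary_map_def)
  have "sphere_avg (\<lambda>\<xi>. (cinner \<xi> z * cinner z \<xi>) ^ N)
      = sphere_avg (\<lambda>\<xi>. complex_of_real ((norm z)\<^sup>2) ^ N * (cinner \<xi> u * cinner u \<xi>) ^ N)"
    by (rule arg_cong[where f = sphere_avg])
       (subst u(2), subst (2) u(2), simp add: cinner_simps power_mult_distrib power2_eq_square mult_ac)
  also have "\<dots> = complex_of_real ((norm z)\<^sup>2) ^ N * sphere_avg (\<lambda>\<xi>. (cinner \<xi> u * cinner u \<xi>) ^ N)"
    by (rule sphere_avg_cmult)
  also have "sphere_avg (\<lambda>\<xi>. (cinner \<xi> u * cinner u \<xi>) ^ N) = sphere_avg (\<lambda>\<xi>. (cinner (\<rho> \<xi>) u * cinner u (\<rho> \<xi>)) ^ N)"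
    by (rule sphere_avg_unitary[OF \<rho>(1), symmetric]) (intro continuous_intros)
  also have "\<dots> = axis_moment TYPE('q) N"
    by (simp add: axis_moment_def \<rho>i flip: \<rho>(2))
  finally show ?thesis .
qed

text \<open>
  A nonzero polynomial cannot vanish at all of the infinitely many squares of natural numbers.
\<close>

lemma sum_powers_eq_coeffs:
  fixes f g :: "nat \<Rightarrow> complex"
  assumes "\<And>t::real. (\<Sum>l\<le>N. f l * complex_of_real (t\<^sup>2) ^ l) = (\<Sum>l\<le>N. g l * complex_of_real (t\<^sup>2) ^ l)"
    and "l \<le> N"
  shows "f l = g l"
proof -
  let ?p = "\<Sum>l\<le>N. monom (f l - g l) l"
  have "poly ?p (complex_of_real (t\<^sup>2)) = 0" for t :: real
    using assms(1)[of t] by (simp add: poly_sum poly_monom algebra_simps sum_subtractf)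
  then have sub: "range (\<lambda>n::nat. complex_of_real ((real n)\<^sup>2)) \<subseteq> {z. poly ?p z = 0}"
    by (intro subsetI, elim rangeE) (simp only: mem_Collect_eq)
  have "inj (\<lambda>n::nat. complex_of_real ((real n)\<^sup>2))"
    by (rule injI) (simp only: of_real_eq_iff power2_eq_iff_nonneg of_nat_0_le_iff of_nat_eq_iff)
  then have "infinite {z. poly ?p z = 0}"
    by (rule infinite_super[OF sub range_inj_infinite])
  then have "?p = 0"
    using poly_roots_finite by blast
  then have "coeff ?p l = 0" by simp
  then show ?thesis
    using assms(2) by (simp add: coeff_sum)
qed

text \<open>
  The average of \<open>\<bar>\<xi> \<cdot> (t x + y')\<bar>\<^bsup>2N\<^esup>\<close> is, by \<open>sphere_avg_power_cinner\<close>, a multiple of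
  \<open>(t\<^sup>2 + \<bar>y'\<bar>\<^sup>2)\<^bsup>N\<^esup>\<close>, and by \<open>sphere_avg_expand\<close> a polynomial in \<open>t\<^sup>2\<close> whose coefficients are
  the joint moments. Comparing coefficients expresses the joint moments by those of a single
  coordinate.
\<close>

lemma sphere_avg_moment_pair:
  fixes x y' :: "complex ^ 'q::finite"
  assumes x: "x \<in> sphere 0 1" and xy: "cinner x y' = 0"
  shows "of_nat ((i + s) choose i) * sphere_avg (\<lambda>\<xi>. (cinner \<xi> x * cinner x \<xi>) ^ i * (cinner \<xi> y' * cinner y' \<xi>) ^ s)
     = complex_of_real ((norm y')\<^sup>2) ^ s * axis_moment TYPE('q) (i + s)"
proof -
  let ?N = "i + s"
  let ?M = "\<lambda>l. sphere_avg (\<lambda>\<xi>. (cinner \<xi> x * cinner x \<xi>) ^ l * (cinner \<xi> y' * cinner y' \<xi>) ^ (?N - l))"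
  let ?m = "axis_moment TYPE('q) ?N"
  let ?r = "complex_of_real ((norm y')\<^sup>2)"
  have yx: "cinner y' x = 0"
    using xy by (metis cnj_cinner complex_cnj_zero)
  have "(\<Sum>l\<le>?N. (of_nat (?N choose l) * of_nat (?N choose l) * ?M l) * complex_of_real (t\<^sup>2) ^ l)
      = (\<Sum>l\<le>?N. (of_nat (?N choose l) * (?r ^ (?N - l) * ?m)) * complex_of_real (t\<^sup>2) ^ l)" for t :: real
  proof -
    define y where "y = complex_of_real t *s x + y'"
    have "complex_of_real ((norm y)\<^sup>2) = complex_of_real (t\<^sup>2) + ?r"
      unfolding cinner_self[symmetric]
      by (simp add: y_def cinner_simps cinner_self_sphere[OF x] xy yx power2_eq_square)
    then have "sphere_avg (\<lambda>\<xi>. (cinner \<xi> y * cinner y \<xi>) ^ ?N) = (complex_of_real (t\<^sup>2) + ?r) ^ ?N * ?m"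
      by (simp only: sphere_avg_power_cinner)
    also have "\<dots> = (\<Sum>l\<le>?N. (of_nat (?N choose l) * (?r ^ (?N - l) * ?m)) * complex_of_real (t\<^sup>2) ^ l)"
      unfolding binomial_ring sum_distrib_right by (simp only: mult_ac)
    finally have 1: "sphere_avg (\<lambda>\<xi>. (cinner \<xi> y * cinner y \<xi>) ^ ?N) = \<dots>" .
    have "sphere_avg (\<lambda>\<xi>. (cinner \<xi> y * cinner y \<xi>) ^ ?N) =
        (\<Sum>l\<le>?N. of_nat (?N choose l) * of_nat (?N choose l) * cnj (complex_of_real t) ^ l * complex_of_real t ^ l * ?M l)"
      using sphere_avg_expand[OF x xy continuous_on_const[of _ 1] y_def, of ?N 0]
      by (simp only: mult_1 add_0_right power_mult_distrib)
    also have "\<dots> = (\<Sum>l\<le>?N. (of_nat (?N choose l) * of_nat (?N choose l) * ?M l) * complex_of_real (t\<^sup>2) ^ l)"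
      by (intro sum.cong refl) (simp add: power2_eq_square power_mult_distrib)
    finally show ?thesis
      using 1 by simp
  qed
  from sum_powers_eq_coeffs[OF this, of i]
  have "of_nat (?N choose i) * of_nat (?N choose i) * ?M i = of_nat (?N choose i) * (?r ^ (?N - i) * ?m)"
    by simp
  then show ?thesis
    by (simp add: mult.assoc)
qed

text \<open>
  Insert \<open>1 = \<Sum> \<bar>\<xi>\<^sub>i\<bar>\<^sup>2\<close> under the average. The summand of the chosen coordinate raises the
  exponent, and the \<open>q - 1\<close> others are joint moments of two orthogonal vectors.
\<close>

lemma axis_moment_Suc:
  "of_nat (Suc N) * axis_moment TYPE('q::finite) N = of_nat (N + CARD('q)) * axis_moment TYPE('q) (Suc N)"
proof -
  let ?i0 = "undefined :: 'q"
  let ?e = "\<lambda>i. axis i 1 :: complex ^ 'q"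
  let ?f = "\<lambda>i \<xi>. (cinner \<xi> (?e ?i0) * cinner (?e ?i0) \<xi>) ^ N * (cinner \<xi> (?e i) * cinner (?e i) \<xi>)"
  let ?m = "axis_moment TYPE('q)"
  have "?m N = sphere_avg (\<lambda>\<xi>. \<Sum>i\<in>UNIV. ?f i \<xi>)"
    unfolding axis_moment_def
  proof (rule sphere_avg_cong)
    fix \<xi> :: "complex ^ 'q" assume "\<xi> \<in> sphere 0 1"
    then have "cinner \<xi> \<xi> = 1"
      by (rule cinner_self_sphere)
    then have "(\<Sum>i\<in>UNIV. cinner \<xi> (?e i) * cinner (?e i) \<xi>) = 1"
      by (simp only: cinner_axis cinner_axis_left) (simp only: cinner_def)
    then show "(cinner \<xi> (?e ?i0) * cinner (?e ?i0) \<xi>) ^ N = (\<Sum>i\<in>UNIV. ?f i \<xi>)"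
      by (simp only: sum_distrib_left [symmetric] mult_1_right)
  qed
  also have "\<dots> = (\<Sum>i\<in>UNIV. sphere_avg (?f i))"
    by (rule sphere_avg_sum) (intro continuous_intros)
  also have "\<dots> = sphere_avg (?f ?i0) + (\<Sum>i\<in>UNIV - {?i0}. sphere_avg (?f i))"
    by (subst sum.remove[of _ ?i0]) auto
  also have "sphere_avg (?f ?i0) = ?m (Suc N)"
    by (simp add: axis_moment_def mult.commute)
  also have "(\<Sum>i\<in>UNIV - {?i0}. sphere_avg (?f i)) = (\<Sum>i\<in>UNIV - {?i0}. ?m (Suc N) / of_nat (Suc N))"
  proof (rule sum.cong[OF refl])
    fix i assume i: "i \<in> UNIV - {?i0}"
    then have "cinner (?e ?i0) (?e i) = 0"
      unfolding cinner_axis by (simp add: axis_def)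
    from sphere_avg_moment_pair[OF _ this, of N 1]
    have "of_nat (Suc N) * sphere_avg (?f i) = ?m (Suc N)"
      by (simp add: norm_axis_1)
    then show "sphere_avg (?f i) = ?m (Suc N) / of_nat (Suc N)"
      by (simp add: field_simps del: of_nat_Suc)
  qed
  also have "\<dots> = of_nat (CARD('q) - 1) * ?m (Suc N) / of_nat (Suc N)"
    by (simp add: card_Diff_subset)
  finally have *: "?m N = ?m (Suc N) + of_nat (CARD('q) - 1) * ?m (Suc N) / of_nat (Suc N)" .
  obtain p where p: "CARD('q) = Suc p"
    by (metis gr0_implies_Suc zero_less_card_finite)
  have "of_nat (Suc N) * ?m N = of_nat (Suc N) * ?m (Suc N) + of_nat p * ?m (Suc N)"
    unfolding * p by (simp add: distrib_left del: of_nat_Suc)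
  then show ?thesis
    by (simp add: p algebra_simps)
qed

lemma axis_moment_eq:
  "axis_moment TYPE('q::finite) N = fact N * fact (CARD('q) - 1) / fact (N + CARD('q) - 1)"
proof (induction N)
  case 0
  then show ?case by (simp add: axis_moment_def)
next
  case (Suc N)
  obtain p where p: "CARD('q) = Suc p"
    by (metis gr0_implies_Suc zero_less_card_finite)
  have "of_nat (N + Suc p) * axis_moment TYPE('q) (Suc N) = of_nat (Suc N) * axis_moment TYPE('q) N"
    using axis_moment_Suc[of N, where 'q = 'q] p by simp
  then have "axis_moment TYPE('q) (Suc N) = of_nat (Suc N) * axis_moment TYPE('q) N / of_nat (N + Suc p)"
    by (simp add: eq_divide_eq mult.commute del: of_nat_Suc of_nat_add)
  then show ?case
    by (simp add: Suc.IH p del: of_nat_Suc of_nat_add) (simp add: algebra_simps)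
qed

lemma sphere_avg_moment:
  fixes x y' :: "complex ^ 'q::finite"
  assumes x: "x \<in> sphere 0 1" and xy: "cinner x y' = 0"
  shows "sphere_avg (\<lambda>\<xi>. (cinner \<xi> x * cinner x \<xi>) ^ i * (cinner \<xi> y' * cinner y' \<xi>) ^ s)
     = complex_of_real ((norm y')\<^sup>2) ^ s * (fact i * fact s * fact (CARD('q) - 1) / fact (i + s + CARD('q) - 1))"
proof -
  let ?C = "of_nat ((i + s) choose i) :: complex"
  let ?R = "complex_of_real ((norm y')\<^sup>2) ^ s"
  have C: "?C * (fact i * fact s) = fact (i + s)"
    by (simp add: binomial_fact)
  have "?C * sphere_avg (\<lambda>\<xi>. (cinner \<xi> x * cinner x \<xi>) ^ i * (cinner \<xi> y' * cinner y' \<xi>) ^ s)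
      = ?R * (fact (i + s) * fact (CARD('q) - 1) / fact (i + s + CARD('q) - 1))"
    by (simp only: sphere_avg_moment_pair[OF x xy] axis_moment_eq)
  also have "\<dots> = ?C * (?R * (fact i * fact s * fact (CARD('q) - 1) / fact (i + s + CARD('q) - 1)))"
    unfolding C[symmetric] by simp
  finally have "?C * sphere_avg (\<lambda>\<xi>. (cinner \<xi> x * cinner x \<xi>) ^ i * (cinner \<xi> y' * cinner y' \<xi>) ^ s) = \<dots>" .
  moreover have "?C \<noteq> 0"
    by simp
  ultimately show ?thesis
    by (rule mult_left_cancel[THEN iffD1, rotated])
qed

section \<open>Orthogonality and convolution of disk polynomials\<close>

lemma alternating_sum_Suc:
  fixes f :: "nat \<Rightarrow> 'a::comm_ring_1"
  shows "(\<Sum>s\<le>Suc k. (-1) ^ s * of_nat (Suc k choose s) * f s)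
       = (\<Sum>s\<le>k. (-1) ^ s * of_nat (k choose s) * f s) - (\<Sum>s\<le>k. (-1) ^ s * of_nat (k choose s) * f (Suc s))"
proof -
  have "(\<Sum>s\<le>k. (-1) ^ s * of_nat (k choose s) * f s) = (\<Sum>s\<le>Suc k. (-1) ^ s * of_nat (k choose s) * f s)"
    by (simp add: binomial_eq_0)
  then show ?thesis
    unfolding sum.atMost_Suc_shift
    by (simp add: algebra_simps sum.distrib sum_negf sum_subtractf)
qed

text \<open>
  The \<open>k\<close>-th iterated difference of \<open>i \<mapsto> i choose j\<close> is \<open>i \<mapsto> i choose (j - k)\<close>. This is the
  identity behind the orthogonality of the Jacobi polynomials.
\<close>

lemma alternating_binomial_sum:
  "k \<le> N \<Longrightarrow> (\<Sum>s\<le>k. (-1) ^ s * of_nat (k choose s) * of_nat ((N - s) choose j))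
     = (if j < k then 0 else of_nat ((N - k) choose (j - k)) :: 'a::comm_ring_1)"
proof (induction k arbitrary: N j)
  case 0
  then show ?case by simp
next
  case (Suc k)
  obtain M where N: "N = Suc M" and M: "k \<le> M"
    using Suc.prems by (cases N) auto
  have "(\<Sum>s\<le>Suc k. (-1) ^ s * of_nat (Suc k choose s) * (of_nat ((N - s) choose j) :: 'a))
      = (if j < k then 0 else of_nat ((N - k) choose (j - k))) - (if j < k then 0 else of_nat ((M - k) choose (j - k)))"
    unfolding alternating_sum_Suc using Suc.IH[of N j] Suc.IH[of M j] M by (simp add: N)
  also have "\<dots> = (if j < Suc k then 0 else of_nat ((N - Suc k) choose (j - Suc k)))"
  proof (cases "j < Suc k")
    case True
    then show ?thesis by (cases "j = k") auto
  next
    case False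
    then obtain i where i: "j - k = Suc i" "j - Suc k = i"
      by (metis Suc_diff_le diff_Suc_Suc not_less)
    have "N - k = Suc (M - k)" "N - Suc k = M - k"
      using M by (auto simp: N Suc_diff_le)
    then show ?thesis
      using False by (simp add: i)
  qed
  finally show ?case .
qed

text \<open>
  The average of a polynomial in \<open>\<bar>x \<cdot> \<xi>\<bar>\<^sup>2\<close>; for \<open>q \<ge> 2\<close> and a unit vector \<open>x\<close> this is the
  integral against \<open>(q - 1) (1 - t)\<^bsup>q-2\<^esup> dt\<close> on the unit interval.
\<close>

definition radial_avg :: "complex ^ 'q::finite \<Rightarrow> complex poly \<Rightarrow> complex" where
  "radial_avg x g = sphere_avg (\<lambda>\<xi>. poly g (cinner \<xi> x * cinner x \<xi>))"

lemma continuous_on_poly_cinner: "continuous_on UNIV (\<lambda>\<xi>. poly g (cinner \<xi> x * cinner x \<xi>))"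
  by (intro continuous_on_compose2[OF continuous_on_poly[OF continuous_on_id]] continuous_intros) auto

lemma radial_avg_diff: "radial_avg x (f - g) = radial_avg x f - radial_avg x g"
  by (simp add: radial_avg_def sphere_avg_diff continuous_on_poly_cinner)

lemma radial_avg_smult: "radial_avg x (smult c f) = c * radial_avg x f"
  by (simp add: radial_avg_def sphere_avg_cmult)

lemma radial_avg_sum: "radial_avg x (\<Sum>i\<in>I. f i) = (\<Sum>i\<in>I. radial_avg x (f i))"
  by (simp add: radial_avg_def poly_sum sphere_avg_sum continuous_on_poly_cinner)

text \<open>
  The beta integral, obtained from the moments (\<open>s = 0\<close>) by \<open>t\<^bsup>N\<^esup> (1 - t) = t\<^bsup>N\<^esup> - t\<^bsup>N+1\<^esup>\<close>.
\<close>

lemma radial_avg_beta: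
  fixes x :: "complex ^ 'q::finite"
  assumes x: "x \<in> sphere 0 1" and q: "CARD('q) = \<alpha> + 2"
  shows "radial_avg x (monom 1 N * [:1, -1:] ^ s) = of_nat (\<alpha> + 1) * fact N * fact (\<alpha> + s) / fact (N + \<alpha> + s + 1)"
proof (induction s arbitrary: N)
  case 0
  have "radial_avg x (monom 1 N) = fact N * fact (\<alpha> + 1) / fact (N + \<alpha> + 1)"
    using sphere_avg_moment[OF x, of 0 N 0] by (simp add: radial_avg_def poly_monom q cinner_def)
  then show ?case by (simp add: algebra_simps)
next
  case (Suc s)
  have "monom 1 N * [:1, -1:] ^ Suc s = monom 1 N * [:1, -1:] ^ s - monom 1 (Suc N) * [:1, -1::complex:] ^ s"
    by (simp add: monom_Suc algebra_simps)
  then have "radial_avg x (monom 1 N * [:1, -1:] ^ Suc s) =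
      of_nat (\<alpha> + 1) * fact N * fact (\<alpha> + s) / fact (N + \<alpha> + s + 1)
      - of_nat (\<alpha> + 1) * fact (Suc N) * fact (\<alpha> + s) / fact (Suc N + \<alpha> + s + 1)"
    by (simp only: radial_avg_diff Suc.IH)
  also have "fact (Suc N) = (of_nat (N + 1) * fact N :: complex)"
    by simp
  also have "fact (Suc N + \<alpha> + s + 1) = (of_nat (N + \<alpha> + s + 2) * fact (N + \<alpha> + s + 1) :: complex)"
    by simp
  also have "of_nat (\<alpha> + 1) * fact N * fact (\<alpha> + s) / fact (N + \<alpha> + s + 1)
      - of_nat (\<alpha> + 1) * (of_nat (N + 1) * fact N) * fact (\<alpha> + s) / (of_nat (N + \<alpha> + s + 2) * fact (N + \<alpha> + s + 1))
      = of_nat (\<alpha> + 1) * fact N * (of_nat (\<alpha> + s + 1) * fact (\<alpha> + s)) / (of_nat (N + \<alpha> + s + 2) * fact (N + \<alpha> + s + 1) :: complex)"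
  proof -
    have frac: "A / D - B / (n * D) = C / (n * D)" if "n \<noteq> 0" "D \<noteq> 0" "A * n - B = C" for A B C D n :: complex
      using that by (simp add: field_simps)
    have n: "of_nat (N + \<alpha> + s + 2) = (of_nat (N + 1) + of_nat (\<alpha> + s + 1) :: complex)"
      by (simp flip: of_nat_add)
    \<comment> \<open>The numerator after clearing denominators, where \<open>n = m + p\<close>.\<close>
    have ring: "c * F * G * (m + p) - c * (m * F) * G = c * F * (p * G)" for c F G m p :: complex
      by (simp add: algebra_simps)
    show ?thesis
    proof (rule frac)
      show "of_nat (N + \<alpha> + s + 2) \<noteq> (0 :: complex)"
        unfolding of_nat_eq_0_iff by simp
    qed (simp_all only: n ring fact_nonzero not_False_eq_True)
  qed
  also have "of_nat (\<alpha> + s + 1) * fact (\<alpha> + s) = (fact (\<alpha> + Suc s) :: complex)"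
    by simp
  also have "of_nat (N + \<alpha> + s + 2) * fact (N + \<alpha> + s + 1) = (fact (N + \<alpha> + Suc s + 1) :: complex)"
    by simp
  finally show ?case .
qed

text \<open>
  Under the average, \<open>\<bar>\<xi> \<cdot> y'\<bar>\<^bsup>2s\<^esup>\<close> acts like a constant multiple of \<open>(1 - \<bar>x \<cdot> \<xi>\<bar>\<^sup>2)\<^bsup>s\<^esup>\<close>. For
  a monomial \<open>g\<close> both sides are known in closed form.
\<close>

lemma sphere_avg_radial_times_power:
  fixes x y' :: "complex ^ 'q::finite"
  assumes x: "x \<in> sphere 0 1" and xy: "cinner x y' = 0" and q: "CARD('q) = \<alpha> + 2"
  shows "sphere_avg (\<lambda>\<xi>. poly g (cinner \<xi> x * cinner x \<xi>) * (cinner \<xi> y' * cinner y' \<xi>) ^ s)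
    = complex_of_real ((norm y')\<^sup>2) ^ s * (fact s * fact \<alpha> / fact (\<alpha> + s)) * radial_avg x (g * [:1, -1:] ^ s)"
proof -
  let ?c = "complex_of_real ((norm y')\<^sup>2) ^ s * (fact s * fact \<alpha> / fact (\<alpha> + s))"
  let ?P = "\<lambda>\<xi>. (cinner \<xi> y' * cinner y' \<xi>) ^ s" and ?T = "\<lambda>\<xi>. cinner \<xi> x * cinner x \<xi>"
  have g: "g = (\<Sum>i\<le>degree g. smult (coeff g i) (monom 1 i))"
    by (subst poly_as_sum_of_monoms[symmetric]) (simp add: smult_monom)
  have 1: "sphere_avg (\<lambda>\<xi>. ?T \<xi> ^ i * ?P \<xi>) = ?c * radial_avg x (monom 1 i * [:1, -1:] ^ s)" for i
  proof -
    have e: "i + s + CARD('q) - 1 = i + \<alpha> + s + 1"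
      by (simp add: q)
    have f: "fact (CARD('q) - 1) = (of_nat (\<alpha> + 1) * fact \<alpha> :: complex)"
      by (simp add: q)
    have "r * (b * c * (n * f) / D) = r * (c * f / E) * (n * b * E / D)" if "E \<noteq> 0" for r b c n f D E :: complex
      using that by simp
    then show ?thesis
      by (simp only: sphere_avg_moment[OF x xy] radial_avg_beta[OF x q] e f fact_nonzero not_False_eq_True)
  qed
  have "poly g t = (\<Sum>i\<le>degree g. coeff g i * t ^ i)" for t
    by (rule poly_altdef)
  then have "sphere_avg (\<lambda>\<xi>. poly g (?T \<xi>) * ?P \<xi>) = sphere_avg (\<lambda>\<xi>. \<Sum>i\<le>degree g. coeff g i * (?T \<xi> ^ i * ?P \<xi>))"
    by (simp only: sum_distrib_right mult.assoc)
  also have "\<dots> = (\<Sum>i\<le>degree g. coeff g i * (?c * radial_avg x (monom 1 i * [:1, -1:] ^ s)))"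
    by (subst sphere_avg_sum) (intro continuous_intros, simp only: sphere_avg_cmult 1)
  also have "\<dots> = ?c * radial_avg x ((\<Sum>i\<le>degree g. smult (coeff g i) (monom 1 i)) * [:1, -1:] ^ s)"
    by (simp only: sum_distrib_right radial_avg_sum mult_smult_left radial_avg_smult sum_distrib_left mult.left_commute)
  finally show ?thesis
    using g by simp
qed

definition disk_coeff :: "nat \<Rightarrow> nat \<Rightarrow> nat \<Rightarrow> nat \<Rightarrow> real" where
  "disk_coeff \<alpha> d k s = real ((k + \<alpha>) choose (k - s)) * real ((k + d) choose s) / real ((k + \<alpha>) choose k)"

text \<open>
  The radial part of the disk polynomials as a polynomial in \<open>t = r\<^sup>2\<close>, normalized to be \<open>1\<close>
  at \<open>1\<close>; \<open>d\<close> is the exponent of the angular part and \<open>k\<close> the degree.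
\<close>

definition disk_radial :: "nat \<Rightarrow> nat \<Rightarrow> nat \<Rightarrow> complex poly" where
  "disk_radial \<alpha> d k = (\<Sum>s\<le>k. smult (complex_of_real (disk_coeff \<alpha> d k s)) ([:-1, 1:] ^ s * monom 1 (k - s)))"

text \<open>
  The average of \<open>t\<^bsup>d+k\<^esup>\<close> against the radial part. It controls both the convolution and, with
  the leading coefficient, the norm of the disk polynomial.
\<close>

definition disk_norm_factor :: "nat \<Rightarrow> nat \<Rightarrow> nat \<Rightarrow> real" where
  "disk_norm_factor \<alpha> d k = fact (\<alpha> + 1) * fact k * fact (k + d) / fact (d + 2 * k + \<alpha> + 1)"

text \<open>
  Multiplied by the factorials of the beta integral, the coefficients turn into those of the
  alternating binomial sum.
\<close>

lemma disk_coeff_fact: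
  assumes "s \<le> k"
  shows "disk_coeff \<alpha> d k s * fact (\<alpha> + s) * fact (d + j + k - s)
       = fact \<alpha> * fact (k + d) * fact j * (real (k choose s) * real ((d + j + k - s) choose j))"
proof -
  have 1: "real ((k + \<alpha>) choose (k - s)) = fact (k + \<alpha>) / (fact (k - s) * fact (\<alpha> + s))"
    using assms by (subst binomial_fact) auto
  have 2: "real ((k + d) choose s) = fact (k + d) / (fact s * fact (k + d - s))"
    using assms by (subst binomial_fact) auto
  have 3: "real ((k + \<alpha>) choose k) = fact (k + \<alpha>) / (fact k * fact \<alpha>)"
    by (subst binomial_fact) auto
  have 4: "real (k choose s) = fact k / (fact s * fact (k - s))"
    using assms by (subst binomial_fact) auto
  have "d + j + k - s - j = k + d - s"
    by simp
  then have 5: "real ((d + j + k - s) choose j) = fact (d + j + k - s) / (fact j * fact (k + d - s))"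
    using assms by (subst binomial_fact) auto
  show ?thesis
    unfolding disk_coeff_def 1 2 3 4 5 by (simp add: field_simps)
qed

text \<open>
  Orthogonality to lower powers. Each summand is a beta integral, and together they form an
  alternating binomial sum, which is \<open>0\<close> for \<open>j < k\<close> and \<open>1\<close> for \<open>j = k\<close>.
\<close>

lemma radial_avg_disk_radial:
  fixes x :: "complex ^ 'q::finite"
  assumes x: "x \<in> sphere 0 1" and q: "CARD('q) = \<alpha> + 2" and j: "j \<le> k"
  shows "radial_avg x (monom 1 (d + j) * disk_radial \<alpha> d k) = (if j = k then disk_norm_factor \<alpha> d k else 0)"
proof -
  let ?w = "disk_coeff \<alpha> d k"
  have "monom 1 (d + j) * ([:-1, 1:] ^ s * monom 1 (k - s)) = smult ((-1) ^ s) (monom (1::complex) (d + j + k - s) * [:1, -1:] ^ s)"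
    if "s \<le> k" for s
  proof -
    have "[:-1, 1::complex:] = smult (-1) [:1, -1:]" by simp
    then have "[:-1, 1::complex:] ^ s = smult ((-1) ^ s) ([:1, -1:] ^ s)"
      by (simp only: smult_power)
    moreover have "monom (1::complex) (d + j) * monom 1 (k - s) = monom 1 (d + j + k - s)"
      using that by (simp add: mult_monom)
    moreover have "monom 1 (d + j) * ([:-1, 1::complex:] ^ s * monom 1 (k - s))
        = (monom 1 (d + j) * monom 1 (k - s)) * [:-1, 1:] ^ s"
      by (simp only: mult_ac)
    ultimately show ?thesis
      by (simp only: mult_smult_right)
  qed
  then have "radial_avg x (monom 1 (d + j) * disk_radial \<alpha> d k) =
    (\<Sum>s\<le>k. complex_of_real (?w s) * ((-1) ^ s * radial_avg x (monom 1 (d + j + k - s) * [:1, -1:] ^ s)))"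
    unfolding disk_radial_def sum_distrib_left mult_smult_right radial_avg_sum radial_avg_smult
    by (intro sum.cong refl) (simp only: atMost_iff radial_avg_smult)
  also have "\<dots> = (\<Sum>s\<le>k. complex_of_real (real (\<alpha> + 1) * fact \<alpha> * fact (k + d) * fact j / fact (d + j + k + \<alpha> + 1)
      * ((-1) ^ s * real (k choose s) * real ((d + j + k - s) choose j))))"
  proof (intro sum.cong refl)
    fix s assume s: "s \<in> {..k}"
    then have e: "d + j + k - s + \<alpha> + s + 1 = d + j + k + \<alpha> + 1" and sk: "s \<le> k"
      by auto
    have "complex_of_real (?w s) * ((-1) ^ s * radial_avg x (monom 1 (d + j + k - s) * [:1, -1:] ^ s))
        = complex_of_real ((-1) ^ s * real (\<alpha> + 1) * (?w s * fact (\<alpha> + s) * fact (d + j + k - s)) / fact (d + j + k + \<alpha> + 1))"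
      unfolding radial_avg_beta[OF x q] e by (simp add: mult_ac)
    also have "\<dots> = complex_of_real (real (\<alpha> + 1) * fact \<alpha> * fact (k + d) * fact j / fact (d + j + k + \<alpha> + 1)
      * ((-1) ^ s * real (k choose s) * real ((d + j + k - s) choose j)))"
      unfolding disk_coeff_fact[OF sk] by (rule arg_cong[where f = complex_of_real]) (simp add: mult_ac)
    finally show "complex_of_real (?w s) * ((-1) ^ s * radial_avg x (monom 1 (d + j + k - s) * [:1, -1:] ^ s)) = \<dots>" .
  qed
  also have "\<dots> = complex_of_real (real (\<alpha> + 1) * fact \<alpha> * fact (k + d) * fact j / fact (d + j + k + \<alpha> + 1)
      * (\<Sum>s\<le>k. (-1) ^ s * real (k choose s) * real ((d + j + k - s) choose j)))"
    by (simp only: of_real_sum sum_distrib_left)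
  also have "(\<Sum>s\<le>k. (-1) ^ s * real (k choose s) * real ((d + j + k - s) choose j)) = (if j = k then 1 else 0)"
    using j by (subst alternating_binomial_sum) auto
  finally have main: "radial_avg x (monom 1 (d + j) * disk_radial \<alpha> d k) =
      complex_of_real (real (\<alpha> + 1) * fact \<alpha> * fact (k + d) * fact j / fact (d + j + k + \<alpha> + 1)
        * (if j = k then 1 else 0))" .
  show ?thesis
  proof (cases "j = k")
    case True
    have e: "d + k + k + \<alpha> + 1 = d + 2 * k + \<alpha> + 1"
      by simp
    have f: "fact (\<alpha> + 1) = (real (\<alpha> + 1) * fact \<alpha> :: real)"
      by simp
    show ?thesis
      unfolding main disk_norm_factor_def f by (simp only: True e simp_thms if_True mult_1 mult_1_right mult_ac)
  next
    case False
    then show ?thesis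
      unfolding main by simp
  qed
qed

lemma radial_avg_disk_radial_poly:
  fixes x :: "complex ^ 'q::finite"
  assumes x: "x \<in> sphere 0 1" and q: "CARD('q) = \<alpha> + 2" and f: "degree f \<le> k"
  shows "radial_avg x (monom 1 d * disk_radial \<alpha> d k * f) = coeff f k * disk_norm_factor \<alpha> d k"
proof -
  let ?g = "disk_radial \<alpha> d k"
  have "f = (\<Sum>j\<le>k. smult (coeff f j) (monom 1 j))"
    by (subst poly_as_sum_of_monoms'[OF f, symmetric]) (simp add: smult_monom)
  then have "radial_avg x (monom 1 d * ?g * f) = radial_avg x (monom 1 d * ?g * (\<Sum>j\<le>k. smult (coeff f j) (monom 1 j)))"
    by simp
  also have "\<dots> = (\<Sum>j\<le>k. coeff f j * radial_avg x (monom 1 (d + j) * ?g))"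
  proof -
    have "monom 1 (d + j) = monom 1 d * monom (1::complex) j" for j
      by (simp add: mult_monom)
    then have "monom 1 d * ?g * monom 1 j = monom 1 (d + j) * ?g" for j
      by (simp only: mult_ac)
    then show ?thesis
      by (simp only: sum_distrib_left mult_smult_right radial_avg_sum radial_avg_smult)
  qed
  also have "\<dots> = (\<Sum>j\<le>k. if j = k then coeff f k * disk_norm_factor \<alpha> d k else 0)"
    by (intro sum.cong refl) (simp add: radial_avg_disk_radial[OF x q])
  also have "\<dots> = coeff f k * disk_norm_factor \<alpha> d k"
    by simp
  finally show ?thesis .
qed

lemma coeff_one_minus_power:
  assumes "l \<le> b" "b \<le> k"
  shows "coeff (monom 1 l * [:1, -1:] ^ (b - l)) k = (if b = k then (-1 :: complex) ^ (k - l) else 0)"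
    and "degree (monom 1 l * [:1, -1::complex:] ^ (b - l)) \<le> b"
proof -
  have deg: "degree ([:1, -1::complex:] ^ n) = n" for n
    by (simp add: degree_power_eq)
  have "coeff ([:1, -1::complex:] ^ n) n = (-1) ^ n" for n
    using lead_coeff_power[of "[:1, -1::complex:]" n] by (simp add: deg)
  then show "coeff (monom 1 l * [:1, -1:] ^ (b - l)) k = (if b = k then (-1 :: complex) ^ (k - l) else 0)"
    using assms by (auto simp: coeff_monom_mult deg coeff_eq_0)
  show "degree (monom 1 l * [:1, -1::complex:] ^ (b - l)) \<le> b"
    using degree_mult_le[of "monom 1 l" "[:1, -1::complex:] ^ (b - l)"] assms
    by (simp add: deg degree_monom_eq)
qed

definition disk_kernel :: "nat \<Rightarrow> nat \<Rightarrow> nat \<Rightarrow> 'q::finite kernel" where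
  "disk_kernel \<alpha> d k x y = cinner x y ^ d * poly (disk_radial \<alpha> d k) (cinner x y * cinner y x)"

lemma poly_disk_radial:
  "poly (disk_radial \<alpha> d k) t = (\<Sum>s\<le>k. complex_of_real (disk_coeff \<alpha> d k s) * ((t - 1) ^ s * t ^ (k - s)))"
  by (simp add: disk_radial_def poly_sum poly_monom)

text \<open>
  The convolution at the heart of the proof. After \<open>sphere_avg_expand\<close> and
  \<open>sphere_avg_radial_times_power\<close> each term is the radial average of \<open>t\<^bsup>d\<^esup>\<close> times the radial
  part times a polynomial of degree \<open>b\<close>, which orthogonality evaluates. For \<open>b = k\<close> the
  constants that remain are the coefficients \<open>disk_coeff\<close> of the radial part itself.
\<close>

lemma disk_kernel_conv_monomial:
  fixes x y :: "complex ^ 'q::finite"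
  assumes x: "x \<in> sphere 0 1" and y: "y \<in> sphere 0 1" and q: "CARD('q) = \<alpha> + 2" and b: "b \<le> k"
  shows "sphere_avg (\<lambda>\<xi>. disk_kernel \<alpha> d k x \<xi> * (cinner \<xi> y ^ (b + d) * cinner y \<xi> ^ b))
     = (if b = k then disk_norm_factor \<alpha> d k * disk_kernel \<alpha> d k x y else 0)"
proof -
  let ?g = "disk_radial \<alpha> d k" and ?\<nu> = "complex_of_real (disk_norm_factor \<alpha> d k)"
  define a where "a = cinner y x"
  define y' where "y' = y - a *s x"
  define W where "W = cinner x y * cinner y x"
  have a': "cnj a = cinner x y"
    by (simp add: a_def cnj_cinner)
  have W_a: "W = cnj a * a"
    by (simp only: W_def a') (simp only: a_def)
  have xy: "cinner x y' = 0"
    by (simp add: y'_def cinner_simps a' cinner_self_sphere[OF x])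
  have ny: "complex_of_real ((norm y')\<^sup>2) = 1 - W"
    unfolding cinner_self[symmetric]
    by (simp add: y'_def cinner_simps a' cinner_self_sphere[OF x] cinner_self_sphere[OF y] W_def a_def)
  have yy: "y = a *s x + y'"
    by (simp add: y'_def)
  \<comment> \<open>The first kernel depends on \<open>\<xi>\<close> only through \<open>x \<cdot> \<xi>\<close>.\<close>
  let ?\<Phi> = "\<lambda>z. z ^ d * poly ?g (cnj z * z)"
  have \<Phi>: "continuous_on UNIV ?\<Phi>"
    by (intro continuous_intros continuous_on_compose2[OF continuous_on_poly[OF continuous_on_id]]) auto
  have "sphere_avg (\<lambda>\<xi>. disk_kernel \<alpha> d k x \<xi> * (cinner \<xi> y ^ (b + d) * cinner y \<xi> ^ b))
      = sphere_avg (\<lambda>\<xi>. ?\<Phi> (cinner x \<xi>) * (cinner \<xi> y ^ (b + d) * cinner y \<xi> ^ b))"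
    by (simp only: disk_kernel_def cnj_cinner mult.commute[of "cinner x _" "cinner _ x"])
  also have "\<dots> = (\<Sum>l\<le>b. of_nat ((b + d) choose (l + d)) * of_nat (b choose l) * cnj a ^ (l + d) * a ^ l *
      sphere_avg (\<lambda>\<xi>. ?\<Phi> (cinner x \<xi>) * (cinner \<xi> x ^ (l + d) * cinner x \<xi> ^ l)
          * (cinner \<xi> y' * cinner y' \<xi>) ^ (b - l)))"
    by (rule sphere_avg_expand[OF x xy \<Phi> yy])
  also have "\<dots> = (\<Sum>l\<le>b. of_nat ((b + d) choose (l + d)) * of_nat (b choose l) * cnj a ^ (l + d) * a ^ l *
      ((1 - W) ^ (b - l) * (fact (b - l) * fact \<alpha> / fact (\<alpha> + (b - l))) *
        (if b = k then (-1) ^ (k - l) * ?\<nu> else 0)))"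
  proof (intro sum.cong refl)
    fix l assume "l \<in> {..b}"
    then have l: "l \<le> b" by simp
    have "sphere_avg (\<lambda>\<xi>. ?\<Phi> (cinner x \<xi>) * (cinner \<xi> x ^ (l + d) * cinner x \<xi> ^ l) * (cinner \<xi> y' * cinner y' \<xi>) ^ (b - l))
      = sphere_avg (\<lambda>\<xi>. poly (monom 1 (d + l) * ?g) (cinner \<xi> x * cinner x \<xi>) * (cinner \<xi> y' * cinner y' \<xi>) ^ (b - l))"
      by (simp only: poly_mult poly_monom cnj_cinner power_mult_distrib power_add mult_ac mult_1)
    also have "\<dots> = (1 - W) ^ (b - l) * (fact (b - l) * fact \<alpha> / fact (\<alpha> + (b - l))) *
        radial_avg x (monom 1 (d + l) * ?g * [:1, -1:] ^ (b - l))"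
      unfolding sphere_avg_radial_times_power[OF x xy q] ny ..
    also have "monom 1 (d + l) = monom 1 d * monom (1::complex) l"
      by (simp add: mult_monom)
    also have "monom 1 d * monom 1 l * ?g * [:1, -1:] ^ (b - l) = monom 1 d * ?g * (monom 1 l * [:1, -1:] ^ (b - l))"
      by (simp only: mult_ac)
    also have "radial_avg x \<dots> = (if b = k then (-1) ^ (k - l) * ?\<nu> else 0)"
      using radial_avg_disk_radial_poly[OF x q order_trans[OF coeff_one_minus_power(2)[OF l b] b]]
        coeff_one_minus_power(1)[OF l b] by simp
    finally show "of_nat ((b + d) choose (l + d)) * of_nat (b choose l) * cnj a ^ (l + d) * a ^ l *
      sphere_avg (\<lambda>\<xi>. ?\<Phi> (cinner x \<xi>) * (cinner \<xi> x ^ (l + d) * cinner x \<xi> ^ l) * (cinner \<xi> y' * cinner y' \<xi>) ^ (b - l))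
      = of_nat ((b + d) choose (l + d)) * of_nat (b choose l) * cnj a ^ (l + d) * a ^ l *
      ((1 - W) ^ (b - l) * (fact (b - l) * fact \<alpha> / fact (\<alpha> + (b - l))) *
        (if b = k then (-1) ^ (k - l) * ?\<nu> else 0))"
      by (simp only:)
  qed
  finally have main: "sphere_avg (\<lambda>\<xi>. disk_kernel \<alpha> d k x \<xi> * (cinner \<xi> y ^ (b + d) * cinner y \<xi> ^ b)) = \<dots>" .
  show ?thesis
  proof (cases "b = k")
    case False
    then show ?thesis using main by simp
  next
    case True
    have "sphere_avg (\<lambda>\<xi>. disk_kernel \<alpha> d k x \<xi> * (cinner \<xi> y ^ (b + d) * cinner y \<xi> ^ b)) =
      (\<Sum>l\<le>k. of_nat ((k + d) choose (l + d)) * of_nat (k choose l) * cnj a ^ (l + d) * a ^ l *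
      ((1 - W) ^ (k - l) * (fact (k - l) * fact \<alpha> / fact (\<alpha> + (k - l))) * ((-1) ^ (k - l) * ?\<nu>)))"
      using main True by simp
    also have "\<dots> = (\<Sum>s\<le>k. of_nat ((k + d) choose (k - s + d)) * of_nat (k choose (k - s)) * cnj a ^ (k - s + d) * a ^ (k - s) *
      ((1 - W) ^ s * (fact s * fact \<alpha> / fact (\<alpha> + s)) * ((-1) ^ s * ?\<nu>)))"
      by (rule sum.reindex_bij_witness[of _ "\<lambda>s. k - s" "\<lambda>s. k - s"]) auto
    also have "\<dots> = (\<Sum>s\<le>k. ?\<nu> * (cnj a ^ d * (complex_of_real (disk_coeff \<alpha> d k s) * ((W - 1) ^ s * W ^ (k - s)))))"
    proof (intro sum.cong refl)
      fix s assume "s \<in> {..k}"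
      then have s: "s \<le> k" by simp
      have 1: "(k + d) choose (k - s + d) = (k + d) choose s"
        using binomial_symmetric[of s "k + d"] s by simp
      \<comment> \<open>The constant of \<open>sphere_avg_radial_times_power\<close> supplies what is missing in \<open>disk_coeff\<close>.\<close>
      have 2: "complex_of_nat (k choose (k - s)) * (fact s * fact \<alpha> / fact (\<alpha> + s))
          = of_nat ((k + \<alpha>) choose (k - s)) / of_nat ((k + \<alpha>) choose k)"
        using s by (simp add: binomial_fact field_simps)
      have 3: "(1 - W) ^ s * (-1) ^ s = (W - 1) ^ s"
        by (simp flip: power_mult_distrib)
      have 4: "cnj a ^ (k - s + d) * a ^ (k - s) = cnj a ^ d * W ^ (k - s)"
        unfolding W_a by (simp only: power_add power_mult_distrib mult_ac)
      have "of_nat ((k + d) choose (k - s + d)) * of_nat (k choose (k - s)) * cnj a ^ (k - s + d) * a ^ (k - s) *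
          ((1 - W) ^ s * (fact s * fact \<alpha> / fact (\<alpha> + s)) * ((-1) ^ s * ?\<nu>))
        = of_nat ((k + d) choose s) * (of_nat (k choose (k - s)) * (fact s * fact \<alpha> / fact (\<alpha> + s)))
          * (cnj a ^ (k - s + d) * a ^ (k - s)) * ((1 - W) ^ s * (-1) ^ s) * ?\<nu>"
        by (simp only: 1 mult_ac)
      also have "\<dots> = ?\<nu> * (cnj a ^ d * (complex_of_real (disk_coeff \<alpha> d k s) * ((W - 1) ^ s * W ^ (k - s))))"
        unfolding 2 3 4 disk_coeff_def by (simp add: mult_ac)
      finally show "of_nat ((k + d) choose (k - s + d)) * of_nat (k choose (k - s)) * cnj a ^ (k - s + d) * a ^ (k - s) *
          ((1 - W) ^ s * (fact s * fact \<alpha> / fact (\<alpha> + s)) * ((-1) ^ s * ?\<nu>)) = \<dots>" .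
    qed
    also have "\<dots> = ?\<nu> * disk_kernel \<alpha> d k x y"
      unfolding disk_kernel_def poly_disk_radial W_def[symmetric] a' by (simp only: sum_distrib_left)
    finally show ?thesis
      using True by simp
  qed
qed

section \<open>Disk kernels as orthogonal projections\<close>

lemma degree_disk_radial: "degree (disk_radial \<alpha> d k) \<le> k"
  unfolding disk_radial_def
proof (rule degree_sum_le)
  fix s assume s: "s \<in> {..k}"
  have "degree ([:-1, 1::complex:] ^ s * monom 1 (k - s)) \<le> degree ([:-1, 1::complex:] ^ s) + degree (monom (1::complex) (k - s))"
    by (rule degree_mult_le)
  also have "\<dots> = k"
    using s by (simp add: degree_power_eq degree_monom_eq)
  finally show "degree (smult (complex_of_real (disk_coeff \<alpha> d k s)) ([:-1, 1:] ^ s * monom 1 (k - s))) \<le> k"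
    using degree_smult_le order_trans by blast
qed simp

text \<open>
  All products \<open>(t - 1)\<^bsup>s\<^esup> t\<^bsup>k-s\<^esup>\<close> are monic of degree \<open>k\<close>, so the leading coefficient is the
  sum of the \<open>disk_coeff\<close>, a Vandermonde convolution.
\<close>

lemma coeff_disk_radial:
  "coeff (disk_radial \<alpha> d k) k = complex_of_real (real ((2 * k + \<alpha> + d) choose k) / real ((k + \<alpha>) choose k))"
proof -
  have "coeff ([:-1, 1::complex:] ^ s * monom 1 (k - s)) k = 1" if "s \<le> k" for s
  proof -
    have "coeff ([:-1, 1::complex:] ^ s) s = 1"
      by (rule coeff_linear_power)
    then show ?thesis
      using that by (simp add: mult.commute[of _ "monom _ _"] coeff_monom_mult)
  qed
  then have "coeff (disk_radial \<alpha> d k) k = (\<Sum>s\<le>k. complex_of_real (disk_coeff \<alpha> d k s))"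
    by (simp add: disk_radial_def coeff_sum)
  also have "\<dots> = complex_of_real (real (\<Sum>s\<le>k. ((k + d) choose s) * ((k + \<alpha>) choose (k - s))) / real ((k + \<alpha>) choose k))"
    by (simp add: disk_coeff_def sum_divide_distrib mult.commute)
  also have "(\<Sum>s\<le>k. ((k + d) choose s) * ((k + \<alpha>) choose (k - s))) = (2 * k + \<alpha> + d) choose k"
  proof -
    have "k + d + (k + \<alpha>) = 2 * k + \<alpha> + d"
      by simp
    then show ?thesis
      using vandermonde[of "k + d" "k + \<alpha>" k] by (simp only:)
  qed
  finally show ?thesis .
qed

lemma disk_weight_commute: "disk_weight \<alpha> m n = disk_weight \<alpha> n m"
  by (simp add: disk_weight_def algebra_simps)

lemma disk_weight_pos: "disk_weight \<alpha> m n > 0"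
  unfolding disk_weight_def by (intro mult_pos_pos divide_pos_pos) auto

text \<open>
  The squared norm of the disk polynomial is its leading coefficient times the average of the
  leading power against it; this is where the weight of the theorem comes from.
\<close>

lemma coeff_times_disk_norm_factor:
  "coeff (disk_radial \<alpha> d k) k * complex_of_real (disk_norm_factor \<alpha> d k) = 1 / complex_of_real (disk_weight \<alpha> (k + d) k)"
proof -
  have 1: "real ((2 * k + \<alpha> + d) choose k) = fact (2 * k + \<alpha> + d) / (fact k * fact (k + \<alpha> + d))"
  proof -
    have "2 * k + \<alpha> + d - k = k + \<alpha> + d" by simp
    then show ?thesis
      using binomial_fact[of k "2 * k + \<alpha> + d", where 'a = real] by (simp only:)
  qed
  have 2: "real ((k + \<alpha>) choose k) = fact (k + \<alpha>) / (fact k * fact \<alpha>)"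
    by (subst binomial_fact) auto
  have 3: "real ((k + d + \<alpha>) choose \<alpha>) = fact (k + \<alpha> + d) / (fact \<alpha> * fact (k + d))"
    by (subst binomial_fact) (auto simp: add_ac)
  have 4: "real ((k + \<alpha>) choose \<alpha>) = fact (k + \<alpha>) / (fact \<alpha> * fact k)"
    by (subst binomial_fact) auto
  have 5: "fact (d + 2 * k + \<alpha> + 1) = (real (k + d) + real k + real \<alpha> + 1) * fact (2 * k + \<alpha> + d)"
    by (simp add: add_ac)
  have 6: "fact (\<alpha> + 1) = (real \<alpha> + 1) * fact \<alpha>"
    by simp
  have n: "real (k + d) + real k + real \<alpha> + 1 \<noteq> 0" "real \<alpha> + 1 \<noteq> 0"
    by (smt (verit) of_nat_0_le_iff)+
  have alg: "F2 / (K * Kad) / (Ka / (K * A)) * (a1 * A * K * Kd / (N * F2)) = 1 / (N / a1 * (Kad / (A * Kd)) * (Ka / (A * K)))"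
    if "F2 \<noteq> 0" "K \<noteq> 0" "Kad \<noteq> 0" "Ka \<noteq> 0" "A \<noteq> 0" "Kd \<noteq> 0" "a1 \<noteq> 0" "N \<noteq> 0"
    for F2 K Kad Ka A Kd a1 N :: real
    using that by (simp add: field_simps)
  have "real ((2 * k + \<alpha> + d) choose k) / real ((k + \<alpha>) choose k) * disk_norm_factor \<alpha> d k = 1 / disk_weight \<alpha> (k + d) k"
    unfolding disk_norm_factor_def disk_weight_def 1 2 3 4 5 6
    by (rule alg) (use n in simp_all)
  then show ?thesis
    unfolding coeff_disk_radial by (metis of_real_1 of_real_divide of_real_mult)
qed

lemma cnj_disk_kernel: "cnj (disk_kernel \<alpha> d k x y) = disk_kernel \<alpha> d k y x"
  unfolding disk_kernel_def poly_disk_radial by (simp add: cnj_cinner mult.commute)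

lemma continuous_on_disk_kernel [continuous_intros]:
  fixes f g :: "'a::topological_space \<Rightarrow> complex ^ 'q::finite"
  assumes "continuous_on S f" "continuous_on S g"
  shows "continuous_on S (\<lambda>z. disk_kernel \<alpha> d k (f z) (g z))"
  unfolding disk_kernel_def poly_disk_radial by (intro continuous_intros assms)

text \<open>
  Only the coefficient of degree \<open>k\<close> of the second radial part contributes, and it vanishes
  for \<open>l < k\<close>.
\<close>

lemma disk_kernel_conv_le:
  fixes x y :: "complex ^ 'q::finite"
  assumes x: "x \<in> sphere 0 1" and y: "y \<in> sphere 0 1" and q: "CARD('q) = \<alpha> + 2" and l: "l \<le> k"
  shows "sphere_avg (\<lambda>\<xi>. disk_kernel \<alpha> d k x \<xi> * disk_kernel \<alpha> d l \<xi> y)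
     = (if l = k then disk_kernel \<alpha> d k x y / complex_of_real (disk_weight \<alpha> (k + d) k) else 0)"
proof -
  let ?c = "coeff (disk_radial \<alpha> d l)"
  have deg: "degree (disk_radial \<alpha> d l) \<le> k"
    using degree_disk_radial[of \<alpha> d l] l by simp
  have exp: "disk_kernel \<alpha> d l \<xi> y = (\<Sum>b\<le>k. ?c b * (cinner \<xi> y ^ (b + d) * cinner y \<xi> ^ b))" for \<xi>
  proof -
    have "poly (disk_radial \<alpha> d l) t = (\<Sum>b\<le>k. ?c b * t ^ b)" for t
      by (subst poly_as_sum_of_monoms'[OF deg, symmetric]) (simp add: poly_sum poly_monom)
    then show ?thesis
      by (simp add: disk_kernel_def sum_distrib_left power_add power_mult_distrib mult_ac)
  qed
  have "sphere_avg (\<lambda>\<xi>. disk_kernel \<alpha> d k x \<xi> * disk_kernel \<alpha> d l \<xi> y)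
      = sphere_avg (\<lambda>\<xi>. \<Sum>b\<le>k. ?c b * (disk_kernel \<alpha> d k x \<xi> * (cinner \<xi> y ^ (b + d) * cinner y \<xi> ^ b)))"
    by (simp only: exp sum_distrib_left mult.left_commute)
  also have "\<dots> = (\<Sum>b\<le>k. ?c b * sphere_avg (\<lambda>\<xi>. disk_kernel \<alpha> d k x \<xi> * (cinner \<xi> y ^ (b + d) * cinner y \<xi> ^ b)))"
    by (subst sphere_avg_sum) (intro continuous_intros, simp only: sphere_avg_cmult)
  also have "\<dots> = (\<Sum>b\<le>k. if b = k then ?c k * (disk_norm_factor \<alpha> d k * disk_kernel \<alpha> d k x y) else 0)"
    by (intro sum.cong refl) (simp add: disk_kernel_conv_monomial[OF x y q])
  also have "\<dots> = ?c k * disk_norm_factor \<alpha> d k * disk_kernel \<alpha> d k x y"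
    by simp
  also have "\<dots> = (if l = k then disk_kernel \<alpha> d k x y / complex_of_real (disk_weight \<alpha> (k + d) k) else 0)"
  proof (cases "l = k")
    case True
    then show ?thesis
      using coeff_times_disk_norm_factor[of \<alpha> d k] by simp
  next
    case False
    then have "degree (disk_radial \<alpha> d l) < k"
      using degree_disk_radial[of \<alpha> d l] l by simp
    then show ?thesis
      using False by (simp add: coeff_eq_0)
  qed
  finally show ?thesis .
qed

text \<open>
  The case \<open>l > k\<close> follows from \<open>l \<le> k\<close> by complex conjugation, as the kernels are Hermitian.
\<close>

lemma disk_kernel_conv:
  fixes x y :: "complex ^ 'q::finite"
  assumes x: "x \<in> sphere 0 1" and y: "y \<in> sphere 0 1" and q: "CARD('q) = \<alpha> + 2"
  shows "sphere_avg (\<lambda>\<xi>. disk_kernel \<alpha> d k x \<xi> * disk_kernel \<alpha> d l \<xi> y)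
     = (if l = k then disk_kernel \<alpha> d k x y / complex_of_real (disk_weight \<alpha> (k + d) k) else 0)"
proof (cases "l \<le> k")
  case True
  then show ?thesis by (rule disk_kernel_conv_le[OF x y q])
next
  case False
  then have "sphere_avg (\<lambda>\<xi>. disk_kernel \<alpha> d l y \<xi> * disk_kernel \<alpha> d k \<xi> x) = 0"
    using disk_kernel_conv_le[OF y x q, of k l d] by simp
  then have "cnj (sphere_avg (\<lambda>\<xi>. disk_kernel \<alpha> d l y \<xi> * disk_kernel \<alpha> d k \<xi> x)) = 0"
    by simp
  then have "sphere_avg (\<lambda>\<xi>. disk_kernel \<alpha> d k x \<xi> * disk_kernel \<alpha> d l \<xi> y) = 0"
    unfolding sphere_avg_cnj[symmetric] by (simp add: cnj_disk_kernel mult.commute)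
  then show ?thesis
    using False by simp
qed

lemma sphere_avg_homogeneous_eq_0:
  fixes f :: "complex ^ 'q::finite \<Rightarrow> complex"
  assumes f: "continuous_on UNIV f" and "s \<noteq> t"
    and hom: "\<And>c \<xi>. cmod c = 1 \<Longrightarrow> f (c *s \<xi>) = c ^ s * cnj c ^ t * f \<xi>"
  shows "sphere_avg f = 0"
proof -
  obtain c where c: "cmod c = 1" "c ^ s * cnj c ^ t = -1"
    using ex_unit_power_eq_minus_one[OF \<open>s \<noteq> t\<close>] by blast
  show ?thesis
    by (rule sphere_avg_eq_0[OF unitary_scalar[OF c(1)] f, of "-1"]) (simp_all add: hom[OF c(1)] c(2))
qed

text \<open>
  \<open>disk_kernel\<close> covers the indices \<open>m \<ge> n\<close>; exchanging \<open>m\<close> and \<open>n\<close> conjugates the kernel, that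
  is, exchanges its arguments.
\<close>

definition full_disk_kernel :: "nat \<Rightarrow> nat \<Rightarrow> nat \<Rightarrow> 'q::finite kernel" where
  "full_disk_kernel \<alpha> m n x y =
     (if n \<le> m then disk_kernel \<alpha> (m - n) n x y else disk_kernel \<alpha> (n - m) m y x)"

lemma cnj_full_disk_kernel: "cnj (full_disk_kernel \<alpha> m n x y) = full_disk_kernel \<alpha> m n y x"
  by (simp add: full_disk_kernel_def cnj_disk_kernel)

lemma continuous_on_full_disk_kernel [continuous_intros]:
  fixes f g :: "'a::topological_space \<Rightarrow> complex ^ 'q::finite"
  assumes "continuous_on S f" "continuous_on S g"
  shows "continuous_on S (\<lambda>z. full_disk_kernel \<alpha> m n (f z) (g z))"
  unfolding full_disk_kernel_def using assms by (cases "n \<le> m") (auto intro!: continuous_intros)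

lemma disk_kernel_scale:
  assumes c: "cmod c = 1"
  shows "disk_kernel \<alpha> d k (c *s x) y = c ^ d * disk_kernel \<alpha> d k x y"
    and "disk_kernel \<alpha> d k x (c *s y) = cnj c ^ d * disk_kernel \<alpha> d k x y"
proof -
  have "c * cnj c = 1"
    using c by (simp add: complex_norm_square[symmetric])
  then have "c * a * (cnj c * b) = a * b" "cnj c * a * (c * b) = a * b" for a b
    by (metis mult.assoc mult.commute mult_1)+
  then show "disk_kernel \<alpha> d k (c *s x) y = c ^ d * disk_kernel \<alpha> d k x y"
    "disk_kernel \<alpha> d k x (c *s y) = cnj c ^ d * disk_kernel \<alpha> d k x y"
    unfolding disk_kernel_def cinner_smult_left cinner_smult_right power_mult_distrib
    by (simp_all only: mult.assoc)
qed

lemma unit_power_diff: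
  assumes "cmod c = 1" "n \<le> m"
  shows "c ^ m * cnj c ^ n = c ^ (m - n)"
proof -
  have "c * cnj c = 1"
    using assms by (simp add: complex_norm_square[symmetric])
  then have "c ^ n * cnj c ^ n = 1"
    by (metis power_mult_distrib power_one)
  moreover have "c ^ m = c ^ (m - n) * c ^ n"
    using assms by (simp flip: power_add)
  ultimately show ?thesis
    by (simp only: mult.assoc mult_1_right)
qed

lemma full_disk_kernel_scale:
  assumes c: "cmod c = 1"
  shows "full_disk_kernel \<alpha> m n (c *s x) y = c ^ m * cnj c ^ n * full_disk_kernel \<alpha> m n x y"
    and "full_disk_kernel \<alpha> m n x (c *s y) = c ^ n * cnj c ^ m * full_disk_kernel \<alpha> m n x y"
proof -
  have cc: "cmod (cnj c) = 1"
    using c by simp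
  have 1: "c ^ m * cnj c ^ n = (if n \<le> m then c ^ (m - n) else cnj c ^ (n - m))"
    using unit_power_diff[OF c, of n m] unit_power_diff[OF cc, of m n] by (auto simp: mult.commute)
  have 2: "c ^ n * cnj c ^ m = (if n \<le> m then cnj c ^ (m - n) else c ^ (n - m))"
    using unit_power_diff[OF c, of m n] unit_power_diff[OF cc, of n m]
    by (cases "n = m") (auto simp: mult.commute)
  show "full_disk_kernel \<alpha> m n (c *s x) y = c ^ m * cnj c ^ n * full_disk_kernel \<alpha> m n x y"
    unfolding 1 full_disk_kernel_def by (simp add: disk_kernel_scale[OF c])
  show "full_disk_kernel \<alpha> m n x (c *s y) = c ^ n * cnj c ^ m * full_disk_kernel \<alpha> m n x y"
    unfolding 2 full_disk_kernel_def by (simp add: disk_kernel_scale[OF c])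
qed

text \<open>
  For \<open>m - n \<noteq> m' - n'\<close> the two kernels transform differently under unit scalars. Otherwise
  both have the same angular exponent, and \<open>disk_kernel_conv\<close> applies, with the arguments
  exchanged if \<open>m < n\<close>.
\<close>

lemma full_disk_kernel_conv:
  fixes x y :: "complex ^ 'q::finite"
  assumes x: "x \<in> sphere 0 1" and y: "y \<in> sphere 0 1" and q: "CARD('q) = \<alpha> + 2"
  shows "sphere_avg (\<lambda>\<xi>. full_disk_kernel \<alpha> m n x \<xi> * full_disk_kernel \<alpha> m' n' \<xi> y)
     = (if (m, n) = (m', n') then full_disk_kernel \<alpha> m n x y / complex_of_real (disk_weight \<alpha> m n) else 0)"
proof (cases "m' + n = m + n'")
  case False
  have "sphere_avg (\<lambda>\<xi>. full_disk_kernel \<alpha> m n x \<xi> * full_disk_kernel \<alpha> m' n' \<xi> y) = 0"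
  proof (rule sphere_avg_homogeneous_eq_0[OF _ False])
    show "continuous_on UNIV (\<lambda>\<xi>. full_disk_kernel \<alpha> m n x \<xi> * full_disk_kernel \<alpha> m' n' \<xi> y)"
      by (intro continuous_intros)
    show "full_disk_kernel \<alpha> m n x (c *s \<xi>) * full_disk_kernel \<alpha> m' n' (c *s \<xi>) y =
        c ^ (m' + n) * cnj c ^ (m + n') * (full_disk_kernel \<alpha> m n x \<xi> * full_disk_kernel \<alpha> m' n' \<xi> y)"
      if "cmod c = 1" for c \<xi>
      by (simp only: full_disk_kernel_scale[OF that] power_add mult_ac)
  qed
  then show ?thesis
    using False by auto
next
  case eq: True
  show ?thesis
  proof (cases "n \<le> m")
    case True
    then have le: "n' \<le> m'" and d: "m' - n' = m - n"
      using eq by auto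
    have e: "(m, n) = (m', n') \<longleftrightarrow> n' = n" and w: "n + (m - n) = m"
      using True le eq by auto
    show ?thesis
      unfolding e using disk_kernel_conv[OF x y q, of "m - n" n n']
      by (simp only: full_disk_kernel_def True le d w if_True)
  next
    case False
    then have le: "\<not> n' \<le> m'" and d: "n' - m' = n - m"
      using eq by auto
    have e: "(m, n) = (m', n') \<longleftrightarrow> m = m'" and w: "m' + (n - m) = n'"
      using False le eq by auto
    have "sphere_avg (\<lambda>\<xi>. full_disk_kernel \<alpha> m n x \<xi> * full_disk_kernel \<alpha> m' n' \<xi> y)
        = sphere_avg (\<lambda>\<xi>. disk_kernel \<alpha> (n - m) m' y \<xi> * disk_kernel \<alpha> (n - m) m \<xi> x)"
      using False le d by (simp add: full_disk_kernel_def mult.commute)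
    also have "\<dots> = (if m = m' then disk_kernel \<alpha> (n - m) m' y x / complex_of_real (disk_weight \<alpha> (m' + (n - m)) m') else 0)"
      by (rule disk_kernel_conv[OF y x q])
    also have "\<dots> = (if (m, n) = (m', n') then full_disk_kernel \<alpha> m n x y / complex_of_real (disk_weight \<alpha> m n) else 0)"
      unfolding e w using False e by (auto simp: full_disk_kernel_def disk_weight_commute[of \<alpha> n' m'])
    finally show ?thesis .
  qed
qed

lemma jacobi_P_disk:
  "jacobi_P k (real \<alpha>) (real d) (2 * t - 1) / jacobi_P k (real \<alpha>) (real d) 1
     = (\<Sum>s\<le>k. disk_coeff \<alpha> d k s * ((t - 1) ^ s * t ^ (k - s)))"
proof -
  have g: "(real a + real b) gchoose s = real ((a + b) choose s)" for a b s
    by (simp add: binomial_gbinomial)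
  have "jacobi_P k (real \<alpha>) (real d) 1 = (\<Sum>s\<le>k. if s = 0 then real ((k + \<alpha>) choose k) else 0)"
    unfolding jacobi_P_def g by (intro sum.cong refl) (auto simp: power_0_left)
  then have 1: "jacobi_P k (real \<alpha>) (real d) 1 = real ((k + \<alpha>) choose k)"
    by simp
  have 2: "(2 * t - 1 - 1) / 2 = t - 1" "(2 * t - 1 + 1) / 2 = t"
    by auto
  show ?thesis
    unfolding 1 unfolding jacobi_P_def g 2 by (simp add: sum_divide_distrib disk_coeff_def mult_ac)
qed

text \<open>
  The polar form \<open>z = r e\<^bsup>i\<theta>\<^esup>\<close> is traded for powers of \<open>z\<close> or its conjugate and polynomials in
  \<open>z cnj z\<close>, for which the algebra of the previous sections and continuity are available.
\<close>

lemma Z_kernel_eq_full_disk_kernel: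
  fixes x y :: "complex ^ 'q::finite"
  assumes q: "CARD('q) = \<alpha> + 2"
  shows "Z_kernel m n x y = full_disk_kernel \<alpha> m n x y"
proof -
  define z where "z = cinner x y"
  have cz: "cnj z = cinner y x"
    by (simp add: z_def cnj_cinner)
  have r: "complex_of_real ((cmod z)\<^sup>2) = z * cnj z"
    by (rule complex_norm_square)
  have z: "z = complex_of_real (cmod z) * cis (Arg z)"
    using rcis_cmod_Arg[of z] by (simp add: rcis_def)
  have rad: "complex_of_real (jacobi_P k (real \<alpha>) (real d) (2 * (cmod z)\<^sup>2 - 1) / jacobi_P k (real \<alpha>) (real d) 1)
      = poly (disk_radial \<alpha> d k) (z * cnj z)" for k d
    unfolding jacobi_P_disk poly_disk_radial r[symmetric] by (simp only: of_real_sum of_real_mult of_real_power of_real_diff of_real_1)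
  have e1: "exp (\<i> * of_int (int d) * complex_of_real (Arg z)) = cis (real d * Arg z)" for d
    by (simp add: cis_conv_exp mult.assoc)
  have e2: "exp (\<i> * of_int (- int d) * complex_of_real (Arg z)) = cis (- (real d * Arg z))" for d
    by (simp add: cis_conv_exp mult.assoc)
  have zd: "complex_of_real (cmod z ^ d) * cis (real d * Arg z) = z ^ d" for d
    by (subst (3) z) (simp add: power_mult_distrib Complex.DeMoivre)
  have czd: "complex_of_real (cmod z ^ d) * cis (- (real d * Arg z)) = cnj z ^ d" for d
    using arg_cong[OF zd[of d], of cnj] by (simp add: cis_cnj)
  show ?thesis
  proof (cases "n \<le> m")
    case True
    then have mn: "nat \<bar>int m - int n\<bar> = m - n" "min m n = n" "int m - int n = int (m - n)"
      by auto
    have "disk_poly \<alpha> m n z = complex_of_real (cmod z ^ (m - n)) * cis (real (m - n) * Arg z)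
        * poly (disk_radial \<alpha> (m - n) n) (z * cnj z)"
      unfolding disk_poly_def Let_def mn rad e1 by (simp only: abs_minus_cancel abs_of_nat nat_int rad)
    then show ?thesis
      using True by (simp only: Z_kernel_def q add_diff_cancel_right' z_def[symmetric] zd full_disk_kernel_def
          disk_kernel_def cz[symmetric] if_True)
  next
    case False
    then have mn: "nat \<bar>int m - int n\<bar> = n - m" "min m n = m" "int m - int n = - int (n - m)"
      by auto
    have "disk_poly \<alpha> m n z = complex_of_real (cmod z ^ (n - m)) * cis (- (real (n - m) * Arg z))
        * poly (disk_radial \<alpha> (n - m) m) (z * cnj z)"
      unfolding disk_poly_def Let_def mn rad e2 by (simp only: abs_minus_cancel abs_of_nat nat_int rad)
    then show ?thesis
      using False by (simp only: Z_kernel_def q add_diff_cancel_right' z_def[symmetric] czd full_disk_kernel_def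
          disk_kernel_def cz[symmetric] if_False mult.commute[of z "cnj z"])
  qed
qed

section \<open>Summability of the coefficients\<close>

lemma integral_surface_measure_eq_avg:
  "(\<integral>x. f x \<partial>surface_measure) = complex_of_real (sphere_area CARD('q)) * sphere_avg (f :: complex ^ 'q::finite \<Rightarrow> complex)"
  using sphere_area_pos[of "CARD('q)"] by (simp add: sphere_avg_def)

text \<open>
  The average divides by the area while the composition of kernels does not; the factor
  \<open>h / sphere_area\<close> accounts for this and for the norm of \<open>Q\<close>.
\<close>

lemma projection_kernel_of_avg:
  fixes Q :: "'q::finite kernel"
  assumes cont: "continuous_on UNIV (\<lambda>p. Q (fst p) (snd p))"
    and herm: "\<And>x y. Q y x = cnj (Q x y)"
    and conv: "\<And>x y. \<lbrakk>x \<in> sphere 0 1; y \<in> sphere 0 1\<rbrakk>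
        \<Longrightarrow> sphere_avg (\<lambda>\<xi>. Q x \<xi> * Q \<xi> y) = Q x y / complex_of_real h"
    and h: "h > 0"
  shows "projection_kernel surface_measure (\<lambda>x y. complex_of_real (h / sphere_area CARD('q)) * Q x y)"
  unfolding projection_kernel_def
proof (intro conjI ballI)
  let ?S = "surface_measure :: (complex ^ 'q) measure"
  let ?c = "complex_of_real (h / sphere_area CARD('q))"
  have "(\<lambda>x. x) \<in> ?S \<rightarrow>\<^sub>M borel"
    by (subst measurable_cong_sets[OF sets_surface_measure refl]) (rule measurable_restrict_space1, simp)
  then have "(\<lambda>p. (fst p, snd p)) \<in> ?S \<Otimes>\<^sub>M ?S \<rightarrow>\<^sub>M borel \<Otimes>\<^sub>M borel"
    by (intro measurable_Pair measurable_compose[OF measurable_fst] measurable_compose[OF measurable_snd])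
  then have id: "(\<lambda>p. p) \<in> ?S \<Otimes>\<^sub>M ?S \<rightarrow>\<^sub>M borel"
    by (simp add: borel_prod)
  have "(\<lambda>p. ?c * Q (fst p) (snd p)) \<in> borel_measurable (?S \<Otimes>\<^sub>M ?S)"
    by (intro borel_measurable_times borel_measurable_const
        measurable_compose[OF id borel_measurable_continuous_onI[OF cont]])
  then show "(\<lambda>(x, y). ?c * Q x y) \<in> borel_measurable (?S \<Otimes>\<^sub>M ?S)"
    by (simp add: case_prod_beta')
  have "compact ((\<lambda>p. Q (fst p) (snd p)) ` (sphere 0 1 \<times> sphere 0 1))"
    by (intro compact_continuous_image continuous_on_subset[OF cont] compact_Times compact_sphere) auto
  then obtain B where "\<forall>z \<in> (\<lambda>p. Q (fst p) (snd p)) ` (sphere 0 1 \<times> sphere 0 1). norm z \<le> B"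
    by (meson bounded_iff compact_imp_bounded)
  then have "cmod (?c * Q x y) \<le> cmod ?c * B" if "x \<in> sphere 0 1" "y \<in> sphere 0 1" for x y
    unfolding norm_mult using that by (intro mult_left_mono) auto
  then show "\<exists>C. \<forall>x\<in>space ?S. \<forall>y\<in>space ?S. cmod (?c * Q x y) \<le> C"
    unfolding space_surface_measure by blast
next
  fix x y :: "complex ^ 'q"
  let ?c = "complex_of_real (h / sphere_area CARD('q))"
  show "?c * Q y x = cnj (?c * Q x y)"
    by (simp add: herm[of y x])
  assume "x \<in> space surface_measure" "y \<in> space surface_measure"
  then have xy: "x \<in> sphere 0 1" "y \<in> sphere 0 1"
    by simp_all
  have "(\<integral>z. ?c * Q x z * (?c * Q z y) \<partial>surface_measure) = ?c * ?c * (\<integral>z. Q x z * Q z y \<partial>surface_measure)"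
    by (simp add: mult_ac)
  also have "\<dots> = ?c * Q x y"
    using h sphere_area_pos[of "CARD('q)"] by (simp add: integral_surface_measure_eq_avg conv[OF xy])
  finally show "(\<integral>z. ?c * Q x z * (?c * Q z y) \<partial>surface_measure) = ?c * Q x y" .
qed

text \<open>
  Both cases of the theorem are instances: \<open>Q\<close> is a family of continuous kernels that agrees
  with \<open>Z\<close> on the sphere and whose multiples by \<open>h / sphere_area\<close> are mutually orthogonal
  projections. The finite partial sums are bounded by a multiple of \<open>\<parallel>J\<parallel>\<^sup>2\<close>.
\<close>

lemma summable_kernel_square_coefficients:
  fixes K J :: "'q::finite kernel" and Q Z :: "'i \<Rightarrow> 'q kernel"
  assumes K: "L2_kernel K" and J: "L2_kernel J" and KJ: "kernel_eq K (kernel_conv J J)"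
    and cont: "\<And>i. continuous_on UNIV (\<lambda>p. Q i (fst p) (snd p))"
    and herm: "\<And>i x y. Q i y x = cnj (Q i x y)"
    and conv: "\<And>i j x y. \<lbrakk>x \<in> sphere 0 1; y \<in> sphere 0 1\<rbrakk>
        \<Longrightarrow> sphere_avg (\<lambda>\<xi>. Q i x \<xi> * Q j \<xi> y) = (if i = j then Q i x y / complex_of_real (h i) else 0)"
    and h: "\<And>i. h i > 0"
    and Z: "\<And>i x y. \<lbrakk>x \<in> sphere 0 1; y \<in> sphere 0 1\<rbrakk> \<Longrightarrow> Z i x y = Q i x y"
  shows "(\<lambda>i. h i * cmod (kernel_inner K (Z i))) summable_on UNIV"
proof -
  let ?S = "surface_measure :: (complex ^ 'q) measure"
  interpret S: finite_measure ?S
    by (rule finite_measure_surface_measure)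
  define w where "w = sphere_area CARD('q)"
  have w: "w > 0"
    by (simp add: w_def sphere_area_pos)
  define P where "P i x y = complex_of_real (h i / w) * Q i x y" for i x y
  have P: "projection_kernel ?S (P i)" for i
    unfolding P_def w_def by (rule projection_kernel_of_avg[OF cont herm _ h]) (simp add: conv)
  have orth: "(\<integral>z. P i x z * P j z y \<partial>?S) = 0" if "i \<noteq> j" "x \<in> space ?S" "y \<in> space ?S" for i j x y
  proof -
    have "(\<integral>z. P i x z * P j z y \<partial>?S) = complex_of_real (h i / w) * complex_of_real (h j / w) * (\<integral>z. Q i x z * Q j z y \<partial>?S)"
      unfolding P_def by (simp add: mult_ac)
    then show ?thesis
      using that by (simp add: integral_surface_measure_eq_avg conv)
  qed
  have Jm [measurable]: "(\<lambda>(x, y). J x y) \<in> borel_measurable (?S \<Otimes>\<^sub>M ?S)"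
    and J2: "integrable (?S \<Otimes>\<^sub>M ?S) (\<lambda>(x, y). (cmod (J x y))\<^sup>2)"
    using J by (auto simp: L2_kernel_def)
  have Km [measurable]: "(\<lambda>(x, y). K x y) \<in> borel_measurable (?S \<Otimes>\<^sub>M ?S)"
    using K by (auto simp: L2_kernel_def)
  let ?k = "\<lambda>i. \<integral>(x, y). (\<integral>s. J x s * J s y \<partial>?S) * cnj (P i x y) \<partial>(?S \<Otimes>\<^sub>M ?S)"
  have coeff: "h i * cmod (kernel_inner K (Z i)) = cmod (?k i) / w\<^sup>2" for i
  proof -
    have "(\<lambda>p. cnj (case p of (x, y) \<Rightarrow> P i x y)) \<in> borel_measurable (?S \<Otimes>\<^sub>M ?S)"
      by (rule borel_measurable_continuous_on[OF continuous_on_cnj[OF continuous_on_id] projection_kernelD(1)[OF P]])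
    then have [measurable]: "(\<lambda>(x, y). cnj (P i x y)) \<in> borel_measurable (?S \<Otimes>\<^sub>M ?S)"
      by (simp add: case_prod_beta')
    have h0: "complex_of_real (h i) \<noteq> 0" "complex_of_real w \<noteq> 0"
      using h[of i] w by auto
    have "(\<integral>(x, y). K x y * cnj (Z i x y) \<partial>(?S \<Otimes>\<^sub>M ?S))
        = (\<integral>(x, y). complex_of_real (w / h i) * (K x y * cnj (P i x y)) \<partial>(?S \<Otimes>\<^sub>M ?S))"
    proof (rule Bochner_Integration.integral_cong)
      fix p assume "p \<in> space (?S \<Otimes>\<^sub>M ?S)"
      then show "(case p of (x, y) \<Rightarrow> K x y * cnj (Z i x y)) = (case p of (x, y) \<Rightarrow> complex_of_real (w / h i) * (K x y * cnj (P i x y)))"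
        using h0 by (auto simp: space_pair_measure Z P_def)
    qed simp
    also have "\<dots> = (\<integral>(x, y). complex_of_real (1 / h i) * ((\<integral>s. J x s * J s y \<partial>?S) * cnj (P i x y)) \<partial>(?S \<Otimes>\<^sub>M ?S))"
    proof (rule integral_cong_AE)
      show "AE p in ?S \<Otimes>\<^sub>M ?S. (case p of (x, y) \<Rightarrow> complex_of_real (w / h i) * (K x y * cnj (P i x y)))
          = (case p of (x, y) \<Rightarrow> complex_of_real (1 / h i) * ((\<integral>s. J x s * J s y \<partial>?S) * cnj (P i x y)))"
        using KJ unfolding kernel_eq_def
      proof eventually_elim
        case (elim p)
        then show ?case
          using h0 by (simp add: case_prod_beta' kernel_conv_def w_def)
      qed
    qed measurable
    also have "\<dots> = complex_of_real (1 / h i) * ?k i"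
      by (simp add: case_prod_beta')
    finally have "kernel_inner K (Z i) = 1 / complex_of_real (w\<^sup>2) * (complex_of_real (1 / h i) * ?k i)"
      unfolding kernel_inner_def w_def by simp
    then have "cmod (kernel_inner K (Z i)) = 1 / w\<^sup>2 * (1 / h i * cmod (?k i))"
      using w h[of i] by (simp add: norm_mult norm_divide norm_power)
    then show ?thesis
      using h[of i] by simp
  qed
  show ?thesis
  proof (rule nonneg_bdd_above_summable_on)
    show "0 \<le> h i * cmod (kernel_inner K (Z i))" for i
      using h[of i] by simp
    let ?B = "(\<integral>(x, y). (cmod (J x y))\<^sup>2 \<partial>(?S \<Otimes>\<^sub>M ?S)) / w\<^sup>2"
    have "(\<Sum>i\<in>F. h i * cmod (kernel_inner K (Z i))) \<le> ?B" if F: "finite F" for F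
    proof -
      have "(\<Sum>i\<in>F. h i * cmod (kernel_inner K (Z i))) = (\<Sum>i\<in>F. cmod (?k i)) / w\<^sup>2"
        by (simp add: coeff sum_divide_distrib)
      also have "\<dots> \<le> ?B"
        using S.sum_kernel_square_pairing_le[where P = P, OF F P orth Jm J2]
        by (intro divide_right_mono) auto
      finally show ?thesis .
    qed
    then show "bdd_above (sum (\<lambda>i. h i * cmod (kernel_inner K (Z i))) ` {F. F \<subseteq> UNIV \<and> finite F})"
      by (intro bdd_aboveI[of _ ?B]) auto
  qed
qed

text \<open>
  Negative powers of \<open>x \<cdot> y\<close> are written as powers of its conjugate: the two agree on the
  circle, and the latter extend continuously to all vectors.
\<close>

definition circle_kernel :: "int \<Rightarrow> 'q::finite kernel" where
  "circle_kernel m x y = (if m \<ge> 0 then cinner x y ^ nat m else cinner y x ^ nat (- m))"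

text \<open>
  For \<open>q = 1\<close> the product is \<open>x * cnj z * z * cnj y\<close> with \<open>z * cnj z = 1\<close>.
\<close>

lemma circle_cinner:
  fixes x y z :: "complex ^ 'q::finite"
  assumes "CARD('q) = 1" and z: "z \<in> sphere 0 1"
  shows "cinner x z * cinner z y = cinner x y"
proof -
  obtain a where a: "(UNIV :: 'q set) = {a}"
    using assms(1) by (metis card_1_singletonE)
  have e: "cinner u v = u $ a * cnj (v $ a)" for u v :: "complex ^ 'q"
    by (simp add: cinner_def a)
  have "z $ a * cnj (z $ a) = 1"
    using cinner_self_sphere[OF z] by (simp add: e)
  then show ?thesis
    by (metis e mult.assoc mult.commute mult_1)
qed

lemma circle_kernel_conv:
  fixes x y :: "complex ^ 'q::finite"
  assumes q: "CARD('q) = 1"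
  shows "sphere_avg (\<lambda>\<xi>. circle_kernel m x \<xi> * circle_kernel n \<xi> y) = (if m = n then circle_kernel m x y else 0)"
proof (cases "m = n")
  case True
  have "circle_kernel m x \<xi> * circle_kernel m \<xi> y = circle_kernel m x y" if "\<xi> \<in> sphere 0 1" for \<xi>
    using circle_cinner[OF q that, of x y] circle_cinner[OF q that, of y x]
    by (simp add: circle_kernel_def mult.commute flip: power_mult_distrib)
  then have "sphere_avg (\<lambda>\<xi>. circle_kernel m x \<xi> * circle_kernel m \<xi> y) = sphere_avg (\<lambda>\<xi> :: complex ^ 'q. circle_kernel m x y)"
    by (rule sphere_avg_cong)
  then show ?thesis
    using True by simp
next
  case False
  have "sphere_avg (\<lambda>\<xi>. circle_kernel m x \<xi> * circle_kernel n \<xi> y) = 0"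
  proof (rule sphere_avg_homogeneous_eq_0)
    show "continuous_on UNIV (\<lambda>\<xi>. circle_kernel m x \<xi> * circle_kernel n \<xi> y)"
      unfolding circle_kernel_def by (cases "m \<ge> 0"; cases "n \<ge> 0") (auto intro!: continuous_intros)
    show "nat (- m) + nat n \<noteq> nat m + nat (- n)"
      using False by linarith
    show "circle_kernel m x (c *s \<xi>) * circle_kernel n (c *s \<xi>) y =
        c ^ (nat (- m) + nat n) * cnj c ^ (nat m + nat (- n)) * (circle_kernel m x \<xi> * circle_kernel n \<xi> y)" for c \<xi>
      unfolding circle_kernel_def
      by (simp add: cinner_smult_left cinner_smult_right power_mult_distrib power_add)
  qed
  then show ?thesis
    using False by simp
qed

lemma Z_circle_kernel_eq:
  fixes x y :: "complex ^ 'q::finite"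
  assumes q: "CARD('q) = 1" and x: "x \<in> sphere 0 1" and y: "y \<in> sphere 0 1"
  shows "Z_circle_kernel m x y = circle_kernel m x y"
proof -
  have "cinner x y * cinner y x = 1"
    using circle_cinner[OF q y, of x x] cinner_self_sphere[OF x] by simp
  then have "inverse (cinner x y) = cinner y x"
    by (rule inverse_unique)
  then show ?thesis
    by (simp add: Z_circle_kernel_def circle_kernel_def power_int_def)
qed

theorem theorem3p5:
  fixes K J :: "'q::finite kernel"
  assumes "L2_kernel K"
    and "zonal_L2_kernel J"
    and "kernel_eq K (kernel_conv J J)"
  shows "(CARD('q) \<ge> 2 \<longrightarrow>
            (\<lambda>(m, n). disk_weight (CARD('q) - 2) m n * cmod (kernel_inner K (Z_kernel m n)))
              summable_on (UNIV :: (nat \<times> nat) set)) \<and>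
         (CARD('q) = 1 \<longrightarrow>
            (\<lambda>m. cmod (kernel_inner K (Z_circle_kernel m))) summable_on (UNIV :: int set))"
proof (intro conjI impI)
  have J: "L2_kernel J"
    using assms(2) by (simp add: zonal_L2_kernel_def)
  {
    assume "CARD('q) \<ge> 2"
    then obtain \<alpha> where q: "CARD('q) = \<alpha> + 2"
      by (metis le_add_diff_inverse2)
    have "(\<lambda>i. disk_weight \<alpha> (fst i) (snd i) * cmod (kernel_inner K (Z_kernel (fst i) (snd i))))
        summable_on (UNIV :: (nat \<times> nat) set)"
    proof (rule summable_kernel_square_coefficients[OF assms(1) J assms(3),
          where Q = "\<lambda>i. full_disk_kernel \<alpha> (fst i) (snd i)"])
      show "continuous_on UNIV (\<lambda>p. full_disk_kernel \<alpha> (fst i) (snd i) (fst p) (snd p) :: complex)"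
        for i :: "nat \<times> nat"
        by (intro continuous_intros)
    qed (simp_all add: cnj_full_disk_kernel full_disk_kernel_conv[OF _ _ q] disk_weight_pos
        Z_kernel_eq_full_disk_kernel[OF q] prod_eq_iff)
    then show "(\<lambda>(m, n). disk_weight (CARD('q) - 2) m n * cmod (kernel_inner K (Z_kernel m n)))
        summable_on (UNIV :: (nat \<times> nat) set)"
      by (simp add: q case_prod_beta')
  }
  assume q: "CARD('q) = 1"
  have "(\<lambda>i. 1 * cmod (kernel_inner K (Z_circle_kernel i))) summable_on (UNIV :: int set)"
  proof (rule summable_kernel_square_coefficients[OF assms(1) J assms(3), where Q = circle_kernel])
    show "continuous_on UNIV (\<lambda>p. circle_kernel i (fst p) (snd p) :: complex)" for i
      unfolding circle_kernel_def by (cases "i \<ge> 0") (auto intro!: continuous_intros)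
    show "circle_kernel i y x = cnj (circle_kernel i x y)" for i and x y :: "complex ^ 'q"
      by (simp add: circle_kernel_def cnj_cinner)
  qed (simp_all add: circle_kernel_conv[OF q] Z_circle_kernel_eq[OF q])
  then show "(\<lambda>m. cmod (kernel_inner K (Z_circle_kernel m))) summable_on (UNIV :: int set)"
    by simp
qed

end
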